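(* If $P$ is a natural unit interval order, then \[X_{\operatorname{inc}(P)}(x,q)=\sum_{C}q^{\mathrm{asc}(C)}\,\mathrm{char}(C),\] where the sum is over the connected components $C$ of the $P$-array crystal $(\mathcal A_P,e_r,f_r,\mathbf{wt})$.
   Context: A natural unit interval order is a finite poset $(P,\le_P)$ on a subset of $\mathbb N$ such that (i) $u<_Pv$ implies $u<v$ as natural numbers, and (ii) if $u<_Pw$ with $v\parallel w$ and $v\parallel u$, then $u<v<w$ as natural numbers. Here $u\parallel v$ means $u,v$ are incomparable in $P$. Such posets are (3+1)-free (they contain no induced disjoint union of a 3-element chain and a 1-element chain), and the constructions below apply to finite (3+1)-free posets. $\mathbb Z_+$ is the set of positive integers. The incomparability graph $\operatorname{inc}(P)$ has vertex set $P$ and an edge between $u$ and $v$ whenever $u\parallel v$. For a finite graph $G=(V,E)$ with $V\subset\mathbb N$, the chromatic quasisymmetric function is $X_G(x,q)=\sum_\kappa q^{\mathrm{asc}(\kappa)}\prod_{v\in V}x_{\kappa(v)}$, summed over all proper colorings $\kappa:V\to\mathbb Z_+$ (adjacent vertices receive different values), where $\mathrm{asc}(\kappa)=\#\{(u,v)\in E\mid \kappa(u)<\kappa(v)\text{ and }u<v\text{ as natural numbers}\}$. $P$-arrays. A $P$-array is an indexing $A=\{A_{i,j}\}$ of the elements of $P$ (each element of $P$ occurs exactly once) by positions $(i,j)\in\mathbb Z_+\times\mathbb Z_+$ such that if $A_{i,j}$ is defined with $j>1$ then $A_{i,j-1}$ is defined and $A_{i,j-1}<_P A_{i,j}$. So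 a $P$-array amounts to an assignment of the elements of $P$ to rows indexed by $\mathbb Z_+$, each row being a chain listed in increasing order. $\mathcal A_P$ is the set of $P$-arrays. The weight $\mathbf{wt}(A)$ is the sequence whose $i$th entry is the number of elements in row $i$. For $A\in\mathcal A_P$, $\mathrm{asc}(A)$ is the number of pairs $(x,y)\in P\times P$ such that $x\parallel y$, $x<y$ as natural numbers, and the row index of $x$ in $A$ is smaller than that of $y$. The statistic $\mathrm{asc}$ is constant on connected components of the $P$-array crystal defined below; for a component $C$, $\mathrm{asc}(C)$ denotes $\mathrm{asc}(A)$ for any $A\in C$. The $r$ alignment. Let $A$ be a $P$-array, $r\ge1$, and let $a_1<_P\cdots<_Pa_m$ and $b_1<_P\cdots<_Pb_n$ be the elements of rows $r$ and $r+1$ of $A$. Define $C(b_k)=k$ and, inductively, $C(a_k)=\max(\{C(b_i)\mid b_i<_Pa_k\}\cup\{C(a_i)\mid 1\le i<k\})+1$ (with $\max\emptyset=0$). The $r$ pre-alignment $\phi_0:\{a_1,\dots,a_m,b_1,\dots,b_n\}\to\{r,r+1\}\times\mathbb Z_+$ sends $a_k\mapsto(r,C(a_k))$ and $b_k\mapsto(r+1,C(b_k))$; the second coordinate is called the column. Given $\phi_k$, select the rightmost element $x$, say mapped to $(i,c)$, such that column $c+1$ of $\phi_k$ is nonempty and contains no $y>_Px$, if such $x$ exists; then $\phi_{k+1}(x)=(i,c+1)$ and $\phi_{k+1}=\phi_k$ elsewhere. If no such $x$ exists, $\phi_k$ is the $r$ alignment of $A$. Operators $f_r,e_r:\mathcal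 A_P\to\mathcal A_P\cup\{0\}$ ($r\ge 1$), where, for $A\in\mathcal A_P$, $a_1<_P\cdots<_Pa_m$ and $b_1<_P\cdots<_Pb_n$ are the elements of rows $r$ and $r+1$ of $A$, and "column" means column in the $r$ alignment of $A$. Lowering: if every column with an entry in row $r$ also contains an entry in row $r+1$, then $f_r(A)=0$. Otherwise let $p$ be minimal such that $a_p$ does not share a column with an element of row $r+1$, and let $t\ge0$ be minimal such that there is no $b_i\not>_Pa_{p+t}$ one column right of $a_{p+t}$. Then $f_r(A)$ is obtained from $A$ by moving $a_p,\dots,a_{p+t}$ to row $r+1$ and any $b_i$ that shares a column with one of these entries to row $r$. Raising: if every column with an entry in row $r+1$ also contains an entry in row $r$, then $e_r(A)=0$. Otherwise let $p$ be maximal such that $b_p$ does not share a column with an entry of row $r$, and let $t\ge0$ be minimal such that there is no $a_i\not>_Pb_{p+t}$ one column right of $b_{p+t}$. Then $e_r(A)$ is obtained from $A$ by moving $b_p,\dots,b_{p+t}$ to row $r$ and any $a_i$ that shares a column with one of these entries to row $r+1$. The $P$-array crystal is the directed colored graph with vertex set $\mathcal A_P$ and an edge of color $r$ from $A$ to $f_r(A)$ whenever $f_r(A)\neq0$ (equivalently, from $e_r(A)$ to $A$ whenever $e_r(A)\ne0$). Connected components are those of the underlying undirected graph. For $S\subseteq\mathcal A_P$, $\mathrm{char}(S)=\sum_{A\in S}\prod_{i\ge1}x_i^{\mathbf{wt}(A)_i}$. *)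

theory Defs
  imports
    "HOL-Library.FuncSet"
    "HOL-Library.Poly_Mapping"
    "HOL-Library.While_Combinator"
    "HOL-Computational_Algebra.Polynomial"
begin

section \<open>Natural unit interval orders and incomparability graphs\<close>

text \<open>A poset is given by its carrier \<open>P\<close> and its reflexive order relation \<open>le\<close>.\<close>

definition pless :: "'a rel \<Rightarrow> 'a \<Rightarrow> 'a \<Rightarrow> bool" where
  "pless le u v \<longleftrightarrow> (u, v) \<in> le \<and> u \<noteq> v"

definition incomparable :: "'a set \<Rightarrow> 'a rel \<Rightarrow> 'a \<Rightarrow> 'a \<Rightarrow> bool" where
  "incomparable P le u v \<longleftrightarrow> u \<in> P \<and> v \<in> P \<and> (u, v) \<notin> le \<and> (v, u) \<notin> le"

definition natural_unit_interval_order :: "nat set \<Rightarrow> nat rel \<Rightarrow> bool" where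
  "natural_unit_interval_order P le \<longleftrightarrow>
     finite P \<and> partial_order_on P le \<and>
     (\<forall>u v. pless le u v \<longrightarrow> u < v) \<and>
     (\<forall>u v w. pless le u w \<and> incomparable P le v w \<and> incomparable P le v u
        \<longrightarrow> u < v \<and> v < w)"

text \<open>Graphs are given by a vertex set and a symmetric edge relation.\<close>

definition inc_edges :: "'a set \<Rightarrow> 'a rel \<Rightarrow> 'a rel" where
  "inc_edges P le = {(u, v). incomparable P le u v}"


section \<open>Formal power series in \<open>x\<^sub>1, x\<^sub>2, \<dots>\<close> over \<open>\<int>[q]\<close>\<close>

text \<open>
  The monomial \<open>\<Prod>\<^sub>i x\<^sub>i ^ m\<^sub>i\<close> is represented by its finitely supported
  exponent sequence \<open>m\<close>, and a series by its coefficient function. The power \<open>q ^ k\<close> is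
  \<open>monom 1 k\<close>.
\<close>

type_synonym monomial = "nat \<Rightarrow>\<^sub>0 nat"
type_synonym series = "monomial \<Rightarrow> int poly"

definition monomial_series :: "monomial \<Rightarrow> series" where
  "monomial_series m = (\<lambda>\<mu>. if \<mu> = m then 1 else 0)"

text \<open>
  Infinite sums of series are taken coefficientwise; a family is summable if each monomial
  has a nonzero coefficient in only finitely many members. For a non-summable family
  \<open>formal_sum\<close> is meaningless.
\<close>

definition formally_summable :: "('i \<Rightarrow> series) \<Rightarrow> 'i set \<Rightarrow> bool" where
  "formally_summable F I \<longleftrightarrow> (\<forall>\<mu>. finite {i \<in> I. F i \<mu> \<noteq> 0})"

definition formal_sum :: "('i \<Rightarrow> series) \<Rightarrow> 'i set \<Rightarrow> series" where
  "formal_sum F I = (\<lambda>\<mu>. \<Sum>i \<in> {i \<in> I. F i \<mu> \<noteq> 0}. F i \<mu>)"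

definition has_formal_sum :: "('i \<Rightarrow> series) \<Rightarrow> 'i set \<Rightarrow> series \<Rightarrow> bool" where
  "has_formal_sum F I S \<longleftrightarrow> formally_summable F I \<and> formal_sum F I = S"


section \<open>The chromatic quasisymmetric function\<close>

text \<open>Colorings \<open>\<kappa> : V \<rightarrow> \<int>\<^sub>+\<close> are extensional functions, so that each is counted once.\<close>

definition proper_colorings :: "nat set \<Rightarrow> nat rel \<Rightarrow> (nat \<Rightarrow> nat) set" where
  "proper_colorings V E = {\<kappa> \<in> V \<rightarrow>\<^sub>E {1..}. \<forall>(u, v) \<in> E. \<kappa> u \<noteq> \<kappa> v}"

definition asc_coloring :: "nat rel \<Rightarrow> (nat \<Rightarrow> nat) \<Rightarrow> nat" where
  "asc_coloring E \<kappa> = card {(u, v) \<in> E. \<kappa> u < \<kappa> v \<and> u < v}"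

definition coloring_monomial :: "nat set \<Rightarrow> (nat \<Rightarrow> nat) \<Rightarrow> monomial" where
  "coloring_monomial V \<kappa> = (\<Sum>v\<in>V. Poly_Mapping.single (\<kappa> v) 1)"

definition chromatic_qsym :: "nat set \<Rightarrow> nat rel \<Rightarrow> series" where
  "chromatic_qsym V E =
     formal_sum
       (\<lambda>\<kappa> \<mu>. monom 1 (asc_coloring E \<kappa>) * monomial_series (coloring_monomial V \<kappa>) \<mu>)
       (proper_colorings V E)"


section \<open>\<open>P\<close>-arrays\<close>

text \<open>A \<open>P\<close>-array is a partial map from positions \<open>(i, j)\<close> to elements of \<open>P\<close>.\<close>

type_synonym parray = "nat \<times> nat \<rightharpoonup> nat"

definition P_arrays :: "nat set \<Rightarrow> nat rel \<Rightarrow> parray set" where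
  "P_arrays P le =
     {A. dom A \<subseteq> {1..} \<times> {1..} \<and> inj_on A (dom A) \<and> ran A = P \<and>
         (\<forall>i j y. 1 < j \<and> A (i, j) = Some y \<longrightarrow>
            (\<exists>x. A (i, j - 1) = Some x \<and> pless le x y))}"

definition row :: "parray \<Rightarrow> nat \<Rightarrow> nat set" where
  "row A i = {x. \<exists>j. A (i, j) = Some x}"

definition wt :: "parray \<Rightarrow> nat \<Rightarrow> nat" where
  "wt A i = card (row A i)"

definition position :: "parray \<Rightarrow> nat \<Rightarrow> nat \<times> nat" where
  "position A x = (THE p. A p = Some x)"

definition asc :: "nat set \<Rightarrow> nat rel \<Rightarrow> parray \<Rightarrow> nat" where
  "asc P le A =
     card {(x, y) \<in> P \<times> P.
             incomparable P le x y \<and> x < y \<and> fst (position A x) < fst (position A y)}"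

definition weight_monomial :: "parray \<Rightarrow> monomial" where
  "weight_monomial A = (\<Sum>i \<in> {i. wt A i \<noteq> 0}. Poly_Mapping.single i (wt A i))"

definition char :: "parray set \<Rightarrow> series" where
  "char S = formal_sum (\<lambda>A. monomial_series (weight_monomial A)) S"


section \<open>The alignment of two adjacent rows\<close>

text \<open>
  Below, \<open>a\<^sub>k\<close> is \<open>A (r, k)\<close> and \<open>b\<^sub>k\<close> is \<open>A (r + 1, k)\<close>. The first coordinate of an
  alignment is always the row of the element in \<open>A\<close>, so only the column is recorded.
  \<open>upper_column le A r k\<close> is \<open>C(a\<^sub>k)\<close>; all columns are positive, so inserting \<open>0\<close>
  below only provides the convention \<open>max \<emptyset> = 0\<close>.
\<close>

context
  notes image_cong [fundef_cong]
begin

fun upper_column :: "nat rel \<Rightarrow> parray \<Rightarrow> nat \<Rightarrow> nat \<Rightarrow> nat" where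
  "upper_column le A r k =
     Max (insert 0 ({j. \<exists>b. A (r + 1, j) = Some b \<and> pless le b (the (A (r, k)))}
                    \<union> upper_column le A r ` {1..<k})) + 1"

end

declare upper_column.simps [simp del]

definition pre_alignment :: "nat rel \<Rightarrow> parray \<Rightarrow> nat \<Rightarrow> nat \<Rightarrow> nat" where
  "pre_alignment le A r x =
     (if x \<in> row A r then upper_column le A r (snd (position A x)) else snd (position A x))"

definition movable :: "nat rel \<Rightarrow> parray \<Rightarrow> nat \<Rightarrow> (nat \<Rightarrow> nat) \<Rightarrow> nat \<Rightarrow> bool" where
  "movable le A r \<phi> x \<longleftrightarrow>
     x \<in> row A r \<union> row A (r + 1) \<and>
     (\<exists>y \<in> row A r \<union> row A (r + 1). \<phi> y = \<phi> x + 1) \<and>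
     \<not> (\<exists>y \<in> row A r \<union> row A (r + 1). \<phi> y = \<phi> x + 1 \<and> pless le x y)"

definition alignment_step :: "nat rel \<Rightarrow> parray \<Rightarrow> nat \<Rightarrow> (nat \<Rightarrow> nat) \<Rightarrow> (nat \<Rightarrow> nat)" where
  "alignment_step le A r \<phi> =
     (let x = arg_max \<phi> (movable le A r \<phi>) in \<phi>(x := \<phi> x + 1))"

definition alignment :: "nat rel \<Rightarrow> parray \<Rightarrow> nat \<Rightarrow> nat \<Rightarrow> nat" where
  "alignment le A r =
     while (\<lambda>\<phi>. \<exists>x. movable le A r \<phi> x) (alignment_step le A r) (pre_alignment le A r)"


section \<open>The crystal operators\<close>

text \<open>
  In this section \<open>col\<close> is the alignment, and \<open>{i, i'} = {r, r + 1}\<close>, where \<open>i\<close> is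
  the row in which the operator looks for the unpaired entry: \<open>i = r\<close> for lowering,
  \<open>i = r + 1\<close> for raising.
\<close>

definition unpaired :: "parray \<Rightarrow> (nat \<Rightarrow> nat) \<Rightarrow> nat \<Rightarrow> nat \<Rightarrow> nat set" where
  "unpaired A col i i' =
     {k. \<exists>x. A (i, k) = Some x \<and> (\<forall>y \<in> row A i'. col y \<noteq> col x)}"

definition run_length ::
  "nat rel \<Rightarrow> parray \<Rightarrow> (nat \<Rightarrow> nat) \<Rightarrow> nat \<Rightarrow> nat \<Rightarrow> nat \<Rightarrow> nat" where
  "run_length le A col i i' p =
     (LEAST t. \<exists>x. A (i, p + t) = Some x \<and>
                   \<not> (\<exists>y \<in> row A i'. col y = col x + 1 \<and> \<not> pless le x y))"

text \<open>
  \<open>slide\<close> moves the elements at positions \<open>p, \<dots>, p + t\<close> of row \<open>i\<close> to row \<open>i'\<close>, and the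
  elements of row \<open>i'\<close> sharing a column with them to row \<open>i\<close>. A \<open>P\<close>-array is determined
  by its rows, which is why the result is specified by them.
\<close>

definition slide ::
  "nat set \<Rightarrow> nat rel \<Rightarrow> parray \<Rightarrow> (nat \<Rightarrow> nat) \<Rightarrow> nat \<Rightarrow> nat \<Rightarrow> nat \<Rightarrow> parray" where
  "slide P le A col i i' p =
     (let t = run_length le A col i i' p;
          U = {x. \<exists>k \<in> {p..p + t}. A (i, k) = Some x};
          D = {y \<in> row A i'. \<exists>x \<in> U. col y = col x}
      in THE B. B \<in> P_arrays P le \<and>
           row B = (row A)(i := (row A i - U) \<union> D, i' := (row A i' - D) \<union> U))"

text \<open>The value \<open>None\<close> represents \<open>0\<close>.\<close>

definition lowering :: "nat set \<Rightarrow> nat rel \<Rightarrow> nat \<Rightarrow> parray \<Rightarrow> parray option" where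
  "lowering P le r A =
     (let col = alignment le A r; K = unpaired A col r (r + 1)
      in if K = {} then None else Some (slide P le A col r (r + 1) (Min K)))"

definition raising :: "nat set \<Rightarrow> nat rel \<Rightarrow> nat \<Rightarrow> parray \<Rightarrow> parray option" where
  "raising P le r A =
     (let col = alignment le A r; K = unpaired A col (r + 1) r
      in if K = {} then None else Some (slide P le A col (r + 1) r (Max K)))"


section \<open>Connected components of the crystal\<close>

text \<open>
  The edges are those given by the lowering operators; the raising operators give the
  same edges, reversed.
\<close>

definition crystal_edges :: "nat set \<Rightarrow> nat rel \<Rightarrow> parray rel" where
  "crystal_edges P le = {(A, B). A \<in> P_arrays P le \<and> (\<exists>r\<ge>1. lowering P le r A = Some B)}"

definition crystal_components :: "nat set \<Rightarrow> nat rel \<Rightarrow> parray set set" where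
  "crystal_components P le =
     P_arrays P le // (crystal_edges P le \<union> (crystal_edges P le)\<inverse>)\<^sup>*"

text \<open>The common value of \<open>asc\<close> on the component \<open>C\<close>.\<close>

definition asc_component :: "nat set \<Rightarrow> nat rel \<Rightarrow> parray set \<Rightarrow> nat" where
  "asc_component P le C = the_elem (asc P le ` C)"


section \<open>Summability of the series above\<close>

lemma lookup_sum_single:
  assumes "finite V"
  shows "Poly_Mapping.lookup (\<Sum>v\<in>V. Poly_Mapping.single (f v) (g v :: nat)) i
       = (\<Sum>v\<in>V. if f v = i then g v else 0)"
  using assms by (induction V rule: finite_induct) (auto simp: lookup_add lookup_single when_def)

lemma chromatic_qsym_summable:
  assumes "finite V"
  shows "formally_summable
     (\<lambda>\<kappa> \<mu>. monom 1 (asc_coloring E \<kappa>) * monomial_series (coloring_monomial V \<kappa>) \<mu>)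
     (proper_colorings V E)"
  unfolding formally_summable_def
proof
  fix \<mu> :: monomial
  have "\<kappa> \<in> V \<rightarrow>\<^sub>E Poly_Mapping.keys \<mu>"
    if "\<kappa> \<in> proper_colorings V E" "coloring_monomial V \<kappa> = \<mu>" for \<kappa>
  proof -
    have "\<kappa> v \<in> Poly_Mapping.keys \<mu>" if "v \<in> V" for v
    proof -
      have "Poly_Mapping.lookup \<mu> (\<kappa> v) = (\<Sum>u\<in>V. if \<kappa> u = \<kappa> v then 1 else 0)"
        using \<open>coloring_monomial V \<kappa> = \<mu>\<close> lookup_sum_single[OF assms, of \<kappa> "\<lambda>_. 1" "\<kappa> v"]
        by (auto simp: coloring_monomial_def)
      also have "\<dots> \<noteq> 0"
        using assms \<open>v \<in> V\<close> by auto
      finally show ?thesis by (simp add: in_keys_iff)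
    qed
    with that(1) show ?thesis
      by (auto simp: proper_colorings_def PiE_iff)
  qed
  then have "{\<kappa> \<in> proper_colorings V E.
      monom 1 (asc_coloring E \<kappa>) * monomial_series (coloring_monomial V \<kappa>) \<mu> \<noteq> 0}
      \<subseteq> V \<rightarrow>\<^sub>E Poly_Mapping.keys \<mu>"
    by (auto simp: monomial_series_def split: if_splits)
  then show "finite {\<kappa> \<in> proper_colorings V E.
      monom 1 (asc_coloring E \<kappa>) * monomial_series (coloring_monomial V \<kappa>) \<mu> \<noteq> 0}"
    by (rule finite_subset) (simp add: finite_PiE assms)
qed

lemma P_array_finite_dom:
  assumes "finite P" "A \<in> P_arrays P le"
  shows "finite (dom A)"
proof -
  have "A ` dom A \<subseteq> Some ` P"
    using assms(2) by (auto simp: P_arrays_def ran_def)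
  then have "finite (A ` dom A)"
    by (rule finite_subset) (simp add: assms(1))
  moreover have "inj_on A (dom A)"
    using assms(2) by (simp add: P_arrays_def)
  ultimately show ?thesis
    by (rule finite_imageD)
qed

lemma P_array_column_le:
  assumes "finite P" "A \<in> P_arrays P le" "(i, j) \<in> dom A"
  shows "j \<le> card P"
proof -
  have step: "(i, j - 1) \<in> dom A" if "1 < j" "(i, j) \<in> dom A" for j
    using assms(2) that unfolding P_arrays_def by blast
  have dn: "(i, j - d) \<in> dom A" if "d < j" for d
    using that
  proof (induction d)
    case (Suc d)
    then show ?case using step[of "j - d"] by auto
  qed (use assms(3) in simp)
  have sub: "Pair i ` {1..j} \<subseteq> dom A"
  proof
    fix p assume "p \<in> Pair i ` {1..j}"
    then obtain k where "p = (i, k)" "1 \<le> k" "k \<le> j" by auto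
    then show "p \<in> dom A" using dn[of "j - k"] by auto
  qed
  have "j = card (Pair i ` {1..j})"
    by (subst card_image) (auto simp: inj_on_def)
  also have "\<dots> \<le> card (dom A)"
    using sub P_array_finite_dom[OF assms(1,2)] by (rule card_mono[rotated])
  also have "\<dots> = card (A ` dom A)"
    using assms(2) by (simp add: card_image P_arrays_def)
  also have "\<dots> \<le> card (Some ` P)"
    using assms(1,2) by (intro card_mono) (auto simp: P_arrays_def ran_def)
  also have "\<dots> = card P"
    by (simp add: card_image)
  finally show ?thesis .
qed

lemma char_summable:
  assumes "finite P" "S \<subseteq> P_arrays P le"
  shows "formally_summable (\<lambda>A. monomial_series (weight_monomial A)) S"
  unfolding formally_summable_def
proof
  fix \<mu> :: monomial
  have *: "dom A \<subseteq> Poly_Mapping.keys \<mu> \<times> {..card P}" "ran A \<subseteq> P"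
    if A: "A \<in> P_arrays P le" and w: "weight_monomial A = \<mu>" for A
  proof -
    have fr: "finite (row A i)" for i
    proof (rule finite_subset[OF _ assms(1)])
      show "row A i \<subseteq> P" using A by (auto simp: P_arrays_def row_def ran_def)
    qed
    have "{i. wt A i \<noteq> 0} \<subseteq> fst ` dom A"
    proof
      fix i assume "i \<in> {i. wt A i \<noteq> 0}"
      then have "row A i \<noteq> {}" by (auto simp: wt_def)
      then obtain j where "(i, j) \<in> dom A" by (auto simp: row_def)
      then show "i \<in> fst ` dom A" by (rule rev_image_eqI) simp
    qed
    then have fw: "finite {i. wt A i \<noteq> 0}"
      using P_array_finite_dom[OF assms(1) A] finite_surj by blast
    show "dom A \<subseteq> Poly_Mapping.keys \<mu> \<times> {..card P}"
    proof
      fix p assume "p \<in> dom A"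
      obtain i j where p: "p = (i, j)" by fastforce
      have "row A i \<noteq> {}" using \<open>p \<in> dom A\<close> p by (auto simp: row_def)
      then have "wt A i \<noteq> 0" using fr by (simp add: wt_def)
      have "Poly_Mapping.lookup \<mu> i = (\<Sum>v | wt A v \<noteq> 0. if v = i then wt A v else 0)"
        using w lookup_sum_single[OF fw, of "\<lambda>v. v" "wt A" i] by (simp add: weight_monomial_def)
      also have "\<dots> = wt A i"
        using fw \<open>wt A i \<noteq> 0\<close> by (simp add: sum.delta)
      finally have "i \<in> Poly_Mapping.keys \<mu>"
        using \<open>wt A i \<noteq> 0\<close> by (simp add: in_keys_iff)
      then show "p \<in> Poly_Mapping.keys \<mu> \<times> {..card P}"
        using P_array_column_le[OF assms(1) A] \<open>p \<in> dom A\<close> p by auto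
    qed
    show "ran A \<subseteq> P" using A by (simp add: P_arrays_def)
  qed
  have "{A \<in> S. monomial_series (weight_monomial A) \<mu> \<noteq> 0}
      \<subseteq> (\<Union>D \<in> Pow (Poly_Mapping.keys \<mu> \<times> {..card P}). {A. dom A = D \<and> ran A \<subseteq> P})"
  proof
    fix A assume "A \<in> {A \<in> S. monomial_series (weight_monomial A) \<mu> \<noteq> 0}"
    then have "A \<in> P_arrays P le" "weight_monomial A = \<mu>"
      using assms(2) by (auto simp: monomial_series_def split: if_splits)
    from *[OF this]
    show "A \<in> (\<Union>D \<in> Pow (Poly_Mapping.keys \<mu> \<times> {..card P}). {A. dom A = D \<and> ran A \<subseteq> P})"
      by blast
  qed
  moreover have "finite \<dots>"
  proof (rule finite_UN_I)
    show "finite (Pow (Poly_Mapping.keys \<mu> \<times> {..card P}))" by simp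
    fix D assume "D \<in> Pow (Poly_Mapping.keys \<mu> \<times> {..card P})"
    then have D: "finite D" by (meson PowD finite_SigmaI finite_atMost finite_keys finite_subset)
    show "finite {A. dom A = D \<and> ran A \<subseteq> P}"
      using finite_set_of_finite_maps[OF D assms(1)] .
  qed
  ultimately show "finite {A \<in> S. monomial_series (weight_monomial A) \<mu> \<noteq> 0}"
    by (rule finite_subset)
qed

end

theory Submission
  imports Defs
begin

text \<open>
  A \<open>P\<close>-array is the same thing as a proper coloring of the incomparability graph: the color of
  an element is its row, and a row is a chain exactly if no two of its elements are incomparable.
  Under this bijection (\<open>bij_betw_coloring_of\<close>) weights correspond to monomials and ascents to
  ascents. Therefore the formula only regroups the sum over all colorings, as soon as the number
  of ascents is known to be constant on components of the crystal.

  So one has to see that a lowering operator yields a \<open>P\<close>-array and preserves the number of ascents.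
  It exchanges between rows \<open>r\<close> and \<open>r + 1\<close> a run \<open>a\<^sub>p, \<dots>, a\<^sub>p\<^sub>+\<^sub>t\<close> with the \<open>t\<close> entries of row
  \<open>r + 1\<close> that share a column with it. Each of these \<open>t\<close> partners is incomparable to two
  consecutive entries of the run (\<open>run_link\<close>), so by the unit interval condition it lies between
  them as a number, and by (3+1)-freeness it is incomparable to no other entry of row \<open>r\<close>. Hence each
  partner contributes one ascent before the exchange and one after it (\<open>asc_swapped\<close>). No other
  pair changes, and the new rows are chains, provided that the run is incomparable to no entry
  of row \<open>r + 1\<close> other than its partners. This last claim is \<open>run_incomparable_lower\<close>: the entries of
  row \<open>r + 1\<close> in columns before the run are below it (\<open>lower_before_first\<close>), those in columns
  after the run are above it (\<open>lower_after_final\<close>).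

  These two lemmas use three properties of the alignment: entries of one row stand in increasing
  columns, and an entry of row \<open>r + 1\<close> stands left of every entry of row \<open>r\<close> above it; an entry
  that has a nonempty next column is below some element of that column; and the occupied columns are
  contiguous. The proof of the last property uses the order in which the alignment moves its
  entries, by means of the invariant \<open>aligning\<close>.
\<close>

section \<open>Arrays as proper colorings\<close>

locale unit_interval_poset =
  fixes P :: "nat set" and le :: "nat rel"
  assumes unit_interval: "natural_unit_interval_order P le"
begin

abbreviation prec :: "nat \<Rightarrow> nat \<Rightarrow> bool" (infix "\<sqsubset>" 50) where
  "u \<sqsubset> v \<equiv> pless le u v"

abbreviation inc :: "nat \<Rightarrow> nat \<Rightarrow> bool" (infix "\<parallel>" 50) where
  "u \<parallel> v \<equiv> incomparable P le u v"

lemma finite_P: "finite P"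
  using unit_interval by (simp add: natural_unit_interval_order_def)

lemma prec_trans: "u \<sqsubset> v \<Longrightarrow> v \<sqsubset> w \<Longrightarrow> u \<sqsubset> w"
  using unit_interval
  unfolding natural_unit_interval_order_def partial_order_on_def preorder_on_def pless_def
  by (metis antisymD transD)

lemma prec_less: "u \<sqsubset> v \<Longrightarrow> u < v"
  using unit_interval by (simp add: natural_unit_interval_order_def)

lemma inc_iff: "u \<parallel> v \<longleftrightarrow> u \<in> P \<and> v \<in> P \<and> u \<noteq> v \<and> \<not> u \<sqsubset> v \<and> \<not> v \<sqsubset> u"
  using unit_interval
  unfolding natural_unit_interval_order_def partial_order_on_def preorder_on_def pless_def
    incomparable_def
  by (metis refl_onD)

lemma inc_sym: "u \<parallel> v \<longleftrightarrow> v \<parallel> u"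
  by (auto simp: incomparable_def)

lemma between_incomparables: "u \<sqsubset> w \<Longrightarrow> v \<parallel> u \<Longrightarrow> v \<parallel> w \<Longrightarrow> u < v \<and> v < w"
  using unit_interval by (simp add: natural_unit_interval_order_def)

text \<open>
  This is (3+1)-freeness. By the unit interval condition \<open>y\<close> lies strictly between \<open>u\<close> and
  \<open>v\<close> as a number, but also strictly between \<open>v\<close> and \<open>w\<close>.
\<close>
lemma no_three_incomparables:
  assumes "u \<sqsubset> v" "v \<sqsubset> w" "y \<parallel> u" "y \<parallel> v" "y \<parallel> w"
  shows False
  using between_incomparables[OF assms(1,3,4)] between_incomparables[OF assms(2,4,5)] by simp

text \<open>
  On a chain the order \<open>\<sqsubset>\<close> agrees with the natural order of numbers, so the rows of an array
  are its color classes listed in increasing numerical order.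
\<close>
definition array_of :: "(nat \<Rightarrow> nat) \<Rightarrow> parray" where
  "array_of \<kappa> = (\<lambda>(i, j). let xs = sorted_list_of_set {v \<in> P. \<kappa> v = i} in
     if 1 \<le> j \<and> j \<le> length xs then Some (xs ! (j - 1)) else None)"

definition coloring_of :: "parray \<Rightarrow> nat \<Rightarrow> nat" where
  "coloring_of A = (\<lambda>v\<in>P. fst (position A v))"

lemma position_eq:
  assumes "A \<in> P_arrays P le" "A p = Some x"
  shows "position A x = p"
  unfolding position_def
proof (rule the_equality)
  fix q assume "A q = Some x"
  then show "q = p"
    using assms unfolding P_arrays_def inj_on_def by (metis (mono_tags, lifting) domI mem_Collect_eq)
qed (use assms in simp)

lemma array_covers:
  assumes "A \<in> P_arrays P le" "x \<in> P"
  obtains i j where "A (i, j) = Some x" "1 \<le> i" "1 \<le> j"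
proof -
  have "x \<in> ran A" using assms by (simp add: P_arrays_def)
  then obtain p where p: "A p = Some x" by (auto simp: ran_def)
  obtain i j where ij: "p = (i, j)" by fastforce
  have "(i, j) \<in> {1..} \<times> {1..}" using assms(1) p ij by (auto simp: P_arrays_def)
  then show thesis using that p ij by auto
qed

lemma row_subset: "A \<in> P_arrays P le \<Longrightarrow> row A i \<subseteq> P"
  by (auto simp: P_arrays_def row_def ran_def)

lemma finite_row: "A \<in> P_arrays P le \<Longrightarrow> finite (row A i)"
  using row_subset finite_P finite_subset by blast

lemma row_eq_fibre:
  assumes "A \<in> P_arrays P le"
  shows "row A i = {v \<in> P. coloring_of A v = i}"
proof (intro set_eqI iffI)
  fix x assume "x \<in> row A i"
  then show "x \<in> {v \<in> P. coloring_of A v = i}"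
    using row_subset[OF assms, of i] position_eq[OF assms]
    by (fastforce simp: row_def coloring_of_def)
next
  fix x assume x: "x \<in> {v \<in> P. coloring_of A v = i}"
  then obtain i' j where "A (i', j) = Some x"
    using array_covers[OF assms, of x] by blast
  then show "x \<in> row A i"
    using x position_eq[OF assms, of "(i', j)" x] by (auto simp: row_def coloring_of_def)
qed

lemma array_defined_below:
  assumes "A \<in> P_arrays P le" "A (i, k) = Some y" "1 \<le> j" "j \<le> k"
  shows "\<exists>x. A (i, j) = Some x"
  using assms(4,3,2)
proof (induction j rule: inc_induct)
  case (step n)
  then obtain x where "A (i, Suc n) = Some x" by auto
  moreover have "1 < Suc n" using step.prems by simp
  ultimately have "\<exists>x. A (i, Suc n - 1) = Some x"
    using assms(1) unfolding P_arrays_def by blast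
  then show ?case by simp
qed auto

lemma array_step:
  assumes "A \<in> P_arrays P le" "A (i, Suc j) = Some y" "A (i, j) = Some x"
  shows "x \<sqsubset> y"
proof -
  have "1 \<le> j" using assms(1,3) by (auto simp: P_arrays_def)
  then have "1 < Suc j" by simp
  then have "\<exists>x. A (i, Suc j - 1) = Some x \<and> x \<sqsubset> y"
    using assms(1,2) unfolding P_arrays_def by blast
  then show ?thesis using assms(3) by simp
qed

lemma array_increasing:
  assumes "A \<in> P_arrays P le" "A (i, j) = Some x" "A (i, k) = Some y" "j < k"
  shows "x \<sqsubset> y"
  using assms(4,3)
proof (induction k arbitrary: y)
  case (Suc k)
  have "1 \<le> j" using assms(1,2) by (auto simp: P_arrays_def)
  then obtain z where z: "A (i, k) = Some z"
    using array_defined_below[OF assms(1) Suc.prems(2), of k] Suc.prems(1) by auto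
  have "z \<sqsubset> y" using array_step[OF assms(1) Suc.prems(2) z] .
  moreover have "j < k \<Longrightarrow> x \<sqsubset> z" using Suc.IH z by simp
  moreover have "j = k \<Longrightarrow> x = z" using z assms(2) by simp
  ultimately show ?case using Suc.prems(1) prec_trans less_Suc_eq by blast
qed simp

lemma row_chain:
  assumes "A \<in> P_arrays P le" "x \<in> row A i" "y \<in> row A i"
  shows "x = y \<or> x \<sqsubset> y \<or> y \<sqsubset> x"
proof -
  obtain j k where "A (i, j) = Some x" "A (i, k) = Some y"
    using assms(2,3) by (auto simp: row_def)
  then show ?thesis
    using array_increasing[OF assms(1), of i] by (metis nat_neq_iff option.inject)
qed

lemma rows_disjoint:
  assumes "A \<in> P_arrays P le" "x \<in> row A i" "x \<in> row A j"
  shows "i = j"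
  using assms by (simp add: row_eq_fibre)

lemma coloring_of_proper:
  assumes A: "A \<in> P_arrays P le"
  shows "coloring_of A \<in> proper_colorings P (inc_edges P le)"
  unfolding proper_colorings_def
proof (intro CollectI conjI ballI)
  show "coloring_of A \<in> P \<rightarrow>\<^sub>E {1..}"
  proof (rule PiE_I)
    fix x assume x: "x \<in> P"
    then obtain i j where "A (i, j) = Some x" "1 \<le> i" using array_covers[OF A] by blast
    then show "coloring_of A x \<in> {1..}" using x position_eq[OF A] by (simp add: coloring_of_def)
  qed (simp add: coloring_of_def)
  fix e assume e: "e \<in> inc_edges P le"
  obtain u v where uv: "e = (u, v)" by fastforce
  then have "u \<parallel> v" using e by (simp add: inc_edges_def)
  then have "coloring_of A u \<noteq> coloring_of A v"
    using row_chain[OF A, of u "coloring_of A u" v] row_eq_fibre[OF A] by (auto simp: inc_iff)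
  then show "case e of (u, v) \<Rightarrow> coloring_of A u \<noteq> coloring_of A v" using uv by simp
qed

lemma proper_coloring_inc:
  "\<kappa> \<in> proper_colorings P (inc_edges P le) \<Longrightarrow> u \<parallel> v \<Longrightarrow> \<kappa> u \<noteq> \<kappa> v"
  by (auto simp: proper_colorings_def inc_edges_def)

lemma row_array_of:
  "row (array_of \<kappa>) i = {v \<in> P. \<kappa> v = i}"
proof -
  let ?xs = "sorted_list_of_set {v \<in> P. \<kappa> v = i}"
  have set: "set ?xs = {v \<in> P. \<kappa> v = i}" using finite_P by simp
  have "row (array_of \<kappa>) i = set ?xs"
  proof (intro set_eqI iffI)
    fix x assume "x \<in> set ?xs"
    then obtain n where "n < length ?xs" "?xs ! n = x" by (auto simp: in_set_conv_nth)
    then have "array_of \<kappa> (i, Suc n) = Some x" by (simp add: array_of_def Let_def)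
    then show "x \<in> row (array_of \<kappa>) i" by (auto simp: row_def)
  next
    fix x assume "x \<in> row (array_of \<kappa>) i"
    then obtain j where "array_of \<kappa> (i, j) = Some x" by (auto simp: row_def)
    then have "1 \<le> j" "j \<le> length ?xs" "x = ?xs ! (j - 1)"
      by (auto simp: array_of_def Let_def split: if_splits)
    then show "x \<in> set ?xs" by (auto intro!: nth_mem simp del: set_sorted_list_of_set)
  qed
  then show ?thesis using set by simp
qed

lemma array_of_in_P_arrays:
  assumes \<kappa>: "\<kappa> \<in> proper_colorings P (inc_edges P le)"
  shows "array_of \<kappa> \<in> P_arrays P le"
  unfolding P_arrays_def
proof (intro CollectI conjI allI impI)
  let ?xs = "\<lambda>i. sorted_list_of_set {v \<in> P. \<kappa> v = i}"
  have some: "1 \<le> j \<and> j \<le> length (?xs i) \<and> x = ?xs i ! (j - 1) \<and> x \<in> P \<and> \<kappa> x = i"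
    if "array_of \<kappa> (i, j) = Some x" for i j x
  proof -
    have "x \<in> row (array_of \<kappa>) i" using that by (auto simp: row_def)
    then show ?thesis
      using that unfolding row_array_of by (auto simp: array_of_def Let_def split: if_splits)
  qed
  show "dom (array_of \<kappa>) \<subseteq> {1..} \<times> {1..}"
  proof
    fix p assume "p \<in> dom (array_of \<kappa>)"
    then obtain i j x where "p = (i, j)" "array_of \<kappa> (i, j) = Some x" by (cases p) auto
    moreover have "1 \<le> \<kappa> x" "1 \<le> j" "\<kappa> x = i"
      using some[OF calculation(2)] \<kappa> by (auto simp: proper_colorings_def PiE_iff)
    ultimately show "p \<in> {1..} \<times> {1..}" by simp
  qed
  show "inj_on (array_of \<kappa>) (dom (array_of \<kappa>))"
  proof (rule inj_onI)
    fix p q assume "p \<in> dom (array_of \<kappa>)" and eq: "array_of \<kappa> p = array_of \<kappa> q"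
    then obtain x i j i' j' where p: "p = (i, j)" "q = (i', j')" "array_of \<kappa> (i, j) = Some x"
      by (cases p, cases q) auto
    then have q: "array_of \<kappa> (i', j') = Some x" using eq by simp
    have "\<kappa> x = i" "\<kappa> x = i'" using some[OF p(3)] some[OF q] by blast+
    then have i: "i' = i" by simp
    have "?xs i ! (j - 1) = ?xs i ! (j' - 1)" "j - 1 < length (?xs i)" "j' - 1 < length (?xs i)"
      using some[OF p(3)] some[OF q] unfolding i by linarith+
    then have "j - 1 = j' - 1" by (simp add: nth_eq_iff_index_eq)
    moreover have "1 \<le> j" "1 \<le> j'" using some[OF p(3)] some[OF q] by blast+
    ultimately show "p = q" using i p(1,2) by simp
  qed
  show "ran (array_of \<kappa>) = P"
  proof -
    have "ran (array_of \<kappa>) = (\<Union>i. row (array_of \<kappa>) i)" by (auto simp: ran_def row_def)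
    then show ?thesis by (auto simp: row_array_of)
  qed
  fix i j y assume j: "1 < j \<and> array_of \<kappa> (i, j) = Some y"
  let ?x = "?xs i ! (j - 2)"
  have y: "j \<le> length (?xs i)" "y = ?xs i ! (j - 1)" "y \<in> P" "\<kappa> y = i"
    using some[of i j y] j by blast+
  have A: "array_of \<kappa> (i, j - 1) = Some ?x"
  proof -
    have "1 \<le> j - 1" "j - 1 \<le> length (?xs i)" "j - 1 - 1 = j - 2" using j y(1) by linarith+
    then show ?thesis by (simp add: array_of_def Let_def del: length_sorted_list_of_set)
  qed
  have "?x < y"
    unfolding y(2) by (rule sorted_wrt_nth_less[of "(<)"]) (use j y(1) in auto)
  moreover have "\<kappa> ?x = \<kappa> y" "?x \<in> P" using some[OF A] unfolding y(4) by blast+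
  ultimately have "?x \<sqsubset> y"
    using proper_coloring_inc[OF \<kappa>, of ?x y] prec_less[of y ?x] y(3) inc_iff[of ?x y] by linarith
  then show "\<exists>x. array_of \<kappa> (i, j - 1) = Some x \<and> x \<sqsubset> y" using A by blast
qed

text \<open>
  Compare the arrays from left to right. If \<open>x\<close> stands in column \<open>j\<close> of \<open>A\<close> and further left in
  \<open>B\<close>, then the entry of \<open>A\<close> at that place is, by induction, also \<open>x\<close>, so \<open>x\<close> would precede
  itself. If it stands further right in \<open>B\<close>, then the entry \<open>z\<close> in column \<open>j\<close> of \<open>B\<close> precedes
  \<open>x\<close>, hence stands left of column \<open>j\<close> in \<open>A\<close>, by induction also in \<open>B\<close>, and \<open>z\<close> would precede
  itself.
\<close>
lemma array_determined_by_rows: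
  assumes A: "A \<in> P_arrays P le" and B: "B \<in> P_arrays P le" and rows: "row A = row B"
  shows "A = B"
proof -
  have le: "A (i, j) \<noteq> None \<Longrightarrow> B (i, j) = A (i, j)"
    if AB: "A \<in> P_arrays P le" "B \<in> P_arrays P le" "row A = row B" for A B i j
  proof (induction j rule: less_induct)
    case (less j)
    then obtain x where x: "A (i, j) = Some x" by auto
    have j: "1 \<le> j" using AB(1) x by (auto simp: P_arrays_def)
    have "x \<in> row A i" using x by (auto simp: row_def)
    then have "x \<in> row B i" using AB(3) by simp
    then obtain k where k: "B (i, k) = Some x" by (auto simp: row_def)
    have k1: "1 \<le> k" using AB(2) k by (auto simp: P_arrays_def)
    have "\<not> k < j"
    proof
      assume kj: "k < j"
      then obtain z where "A (i, k) = Some z"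
        using array_defined_below[OF AB(1) x k1] by auto
      moreover from this have "B (i, k) = A (i, k)" using less.IH[OF kj] by simp
      ultimately have "A (i, k) = Some x" using k by simp
      then have "x < x" using prec_less[OF array_increasing[OF AB(1) _ x kj]] by simp
      then show False by simp
    qed
    moreover have "\<not> j < k"
    proof
      assume jk: "j < k"
      then obtain z where z: "B (i, j) = Some z"
        using array_defined_below[OF AB(2) k j] by auto
      then have "z \<in> row B i" by (auto simp: row_def)
      then have "z \<in> row A i" using AB(3) by simp
      then obtain l where l: "A (i, l) = Some z" by (auto simp: row_def)
      have "z \<sqsubset> x" using array_increasing[OF AB(2) z k jk] .
      then have "z < x" by (rule prec_less)
      moreover have "j < l \<Longrightarrow> x < z" using prec_less[OF array_increasing[OF AB(1) x l]] .
      moreover have "l = j \<Longrightarrow> z = x" using l x by simp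
      ultimately have "l < j" by (cases l j rule: linorder_cases) auto
      then have "B (i, l) = Some z" using less.IH l by simp
      then have "z < z" using prec_less[OF array_increasing[OF AB(2) _ z \<open>l < j\<close>]] by simp
      then show False by simp
    qed
    ultimately have "k = j" by simp
    then show ?case using k x by simp
  qed
  show ?thesis
  proof
    fix p :: "nat \<times> nat"
    obtain i j where p: "p = (i, j)" by fastforce
    show "A p = B p"
      using le[OF A B rows, of i j] le[OF B A rows[symmetric], of i j] p by metis
  qed
qed

lemma coloring_of_array_of:
  assumes \<kappa>: "\<kappa> \<in> proper_colorings P (inc_edges P le)"
  shows "coloring_of (array_of \<kappa>) = \<kappa>"
proof
  fix v
  show "coloring_of (array_of \<kappa>) v = \<kappa> v"
  proof (cases "v \<in> P")
    case True
    then have "v \<in> row (array_of \<kappa>) (\<kappa> v)" by (simp add: row_array_of)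
    then show ?thesis unfolding row_eq_fibre[OF array_of_in_P_arrays[OF \<kappa>]] by blast
  next
    case False
    have "\<kappa> \<in> P \<rightarrow>\<^sub>E {1..}" using \<kappa> by (simp add: proper_colorings_def)
    from PiE_arb[OF this False] show ?thesis using False by (simp add: coloring_of_def)
  qed
qed

lemma bij_betw_coloring_of:
  "bij_betw coloring_of (P_arrays P le) (proper_colorings P (inc_edges P le))"
  unfolding bij_betw_def
proof
  show "inj_on coloring_of (P_arrays P le)"
  proof (rule inj_onI)
    fix A B assume "A \<in> P_arrays P le" "B \<in> P_arrays P le" "coloring_of A = coloring_of B"
    then show "A = B" by (intro array_determined_by_rows) (auto simp: row_eq_fibre)
  qed
  show "coloring_of ` P_arrays P le = proper_colorings P (inc_edges P le)"
  proof (intro equalityI subsetI)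
    fix \<kappa> assume \<kappa>: "\<kappa> \<in> proper_colorings P (inc_edges P le)"
    note A = array_of_in_P_arrays[OF \<kappa>]
    have "\<kappa> = coloring_of (array_of \<kappa>)" using coloring_of_array_of[OF \<kappa>] by (rule sym)
    then show "\<kappa> \<in> coloring_of ` P_arrays P le" using A by (rule image_eqI)
  qed (use coloring_of_proper in blast)
qed

lemma asc_coloring_of:
  assumes A: "A \<in> P_arrays P le"
  shows "asc_coloring (inc_edges P le) (coloring_of A) = asc P le A"
  unfolding asc_coloring_def asc_def
proof (rule arg_cong[where f = card], intro set_eqI)
  fix e :: "nat \<times> nat"
  obtain u v where e: "e = (u, v)" by fastforce
  have "u \<parallel> v \<Longrightarrow> coloring_of A u = fst (position A u) \<and> coloring_of A v = fst (position A v)"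
    by (simp add: coloring_of_def inc_iff)
  then show "e \<in> {(u, v) \<in> inc_edges P le. coloring_of A u < coloring_of A v \<and> u < v} \<longleftrightarrow>
      e \<in> {(x, y) \<in> P \<times> P. x \<parallel> y \<and> x < y \<and> fst (position A x) < fst (position A y)}"
    unfolding e inc_edges_def using inc_iff[of u v] by auto
qed

lemma coloring_monomial_coloring_of:
  assumes A: "A \<in> P_arrays P le"
  shows "coloring_monomial P (coloring_of A) = weight_monomial A"
proof (rule poly_mapping_eqI)
  fix i
  have fin: "finite {i. wt A i \<noteq> 0}"
  proof (rule finite_subset)
    show "{i. wt A i \<noteq> 0} \<subseteq> coloring_of A ` P"
    proof
      fix i assume "i \<in> {i. wt A i \<noteq> 0}"
      then have "row A i \<noteq> {}" by (auto simp: wt_def)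
      then show "i \<in> coloring_of A ` P" by (auto simp: row_eq_fibre[OF A])
    qed
  qed (use finite_P in simp)
  have "Poly_Mapping.lookup (coloring_monomial P (coloring_of A)) i
      = (\<Sum>v\<in>P. if coloring_of A v = i then 1 else 0)"
    unfolding coloring_monomial_def by (rule lookup_sum_single[OF finite_P])
  also have "\<dots> = wt A i"
    using finite_P by (simp add: wt_def row_eq_fibre[OF A] flip: sum.inter_filter)
  also have "\<dots> = Poly_Mapping.lookup (weight_monomial A) i"
    unfolding weight_monomial_def lookup_sum_single[OF fin] using fin by (simp add: sum.delta)
  finally show "Poly_Mapping.lookup (coloring_monomial P (coloring_of A)) i
      = Poly_Mapping.lookup (weight_monomial A) i" .
qed

end

section \<open>Invariants of the alignment\<close>

locale adjacent_rows = unit_interval_poset +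
  fixes A :: parray and r :: nat
  assumes array: "A \<in> P_arrays P le"
begin

definition upper :: "nat set" where "upper = row A r"
definition lower :: "nat set" where "lower = row A (r + 1)"
definition entries :: "nat set" where "entries = upper \<union> lower"

abbreviation pre :: "nat \<Rightarrow> nat" where "pre \<equiv> pre_alignment le A r"

lemma upper_lower_disjoint: "x \<in> upper \<Longrightarrow> x \<in> lower \<Longrightarrow> False"
  using rows_disjoint[OF array, of x r "r + 1"] by (simp add: upper_def lower_def)

lemma finite_entries: "finite entries"
  by (simp add: entries_def upper_def lower_def finite_row[OF array])

lemma entries_subset: "x \<in> entries \<Longrightarrow> x \<in> P"
  using row_subset[OF array] by (auto simp: entries_def upper_def lower_def)

lemma same_row_chain:
  assumes "u \<in> entries" "v \<in> entries" "u \<in> upper \<longleftrightarrow> v \<in> upper" "u \<noteq> v"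
  shows "u \<sqsubset> v \<or> v \<sqsubset> u"
  using assms row_chain[OF array, of u _ v] by (auto simp: entries_def upper_def lower_def)

lemma pre_upper:
  assumes "A (r, k) = Some x"
  shows "pre x = upper_column le A r k"
proof -
  have "x \<in> row A r" using assms by (auto simp: row_def)
  then show ?thesis using position_eq[OF array assms] by (simp add: pre_alignment_def)
qed

lemma pre_lower:
  assumes "A (r + 1, k) = Some x"
  shows "pre x = k"
proof -
  have "x \<in> row A (r + 1)" using assms by (auto simp: row_def)
  then have "x \<notin> row A r" using rows_disjoint[OF array, of x r "r + 1"] by auto
  then show ?thesis using position_eq[OF array assms] by (simp add: pre_alignment_def)
qed

lemma finite_upper_column_candidates:
  "finite (insert 0 ({j. \<exists>b. A (r + 1, j) = Some b \<and> b \<sqsubset> y} \<union> upper_column le A r ` {1..<k}))"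
proof -
  have "{j. \<exists>b. A (r + 1, j) = Some b \<and> b \<sqsubset> y} \<subseteq> snd ` dom A"
    by (force simp: image_iff)
  then show ?thesis
    using P_array_finite_dom[OF finite_P array] finite_subset by fastforce
qed

lemma upper_position:
  assumes "x \<in> upper" obtains k where "A (r, k) = Some x" "1 \<le> k"
proof -
  obtain k where "A (r, k) = Some x" using assms by (auto simp: upper_def row_def)
  moreover from this have "1 \<le> k" using array by (auto simp: P_arrays_def)
  ultimately show thesis using that by blast
qed

lemma lower_position:
  assumes "x \<in> lower" obtains k where "A (r + 1, k) = Some x" "1 \<le> k"
proof -
  obtain k where "A (r + 1, k) = Some x" using assms by (auto simp: lower_def row_def)
  moreover from this have "1 \<le> k" using array by (auto simp: P_arrays_def)
  ultimately show thesis using that by blast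
qed

lemma position_less:
  assumes "A (i, j) = Some x" "A (i, k) = Some y" "x \<sqsubset> y"
  shows "j < k"
proof (rule ccontr)
  assume "\<not> j < k"
  then have "x = y \<or> y \<sqsubset> x"
    using array_increasing[OF array assms(2,1)] assms(1,2) by (cases "j = k") auto
  then show False using prec_less[OF assms(3)] prec_less[of y x] by auto
qed

text \<open>
  The premise on the rows excludes only \<open>u\<close> in the upper and \<open>v\<close> in the lower row: the column
  of a lower entry takes no account of the upper row.
\<close>
lemma pre_mono:
  assumes u: "u \<in> entries" and v: "v \<in> entries" and uv: "u \<sqsubset> v"
    and rows: "u \<in> upper \<longrightarrow> v \<in> upper"
  shows "pre u < pre v"
proof (cases "v \<in> upper")
  case True
  then obtain k where k: "A (r, k) = Some v" by (rule upper_position)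
  let ?S = "insert 0 ({j. \<exists>b. A (r + 1, j) = Some b \<and> b \<sqsubset> v} \<union> upper_column le A r ` {1..<k})"
  have pre_v: "pre v = Max ?S + 1"
    using pre_upper[OF k] upper_column.simps[of le A r k] k by simp
  have "pre u \<in> ?S"
  proof (cases "u \<in> upper")
    case True
    then obtain j where j: "A (r, j) = Some u" "1 \<le> j" by (rule upper_position)
    then have "j < k" using position_less[OF _ k uv] by blast
    then show ?thesis using pre_upper[OF j(1)] j(2) by auto
  next
    case False
    then have "u \<in> lower" using u by (simp add: entries_def)
    then obtain j where j: "A (r + 1, j) = Some u" by (rule lower_position)
    then show ?thesis using pre_lower[OF j] uv by blast
  qed
  then have "pre u \<le> Max ?S" using finite_upper_column_candidates by (rule Max_ge[rotated])
  then show ?thesis using pre_v by simp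
next
  case False
  then have "u \<in> lower" "v \<in> lower" using u v rows by (auto simp: entries_def)
  then obtain j k where jk: "A (r + 1, j) = Some u" "A (r + 1, k) = Some v"
    using lower_position by metis
  then show ?thesis using position_less[OF jk uv] pre_lower by simp
qed

lemma pre_pos:
  assumes "v \<in> entries"
  shows "1 \<le> pre v"
proof (cases "v \<in> upper")
  case True
  then obtain k where "A (r, k) = Some v" by (rule upper_position)
  then show ?thesis using pre_upper upper_column.simps[of le A r k] by simp
next
  case False
  then have "v \<in> lower" using assms by (simp add: entries_def)
  then obtain j where "A (r + 1, j) = Some v" "1 \<le> j" by (rule lower_position)
  then show ?thesis using pre_lower by simp
qed

text \<open>
  The maximum that defines the column of an entry is attained, and it is attained by an entry
  below it. So initially no column is skipped; this is the source of contiguity later on.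
\<close>
lemma pre_predecessor:
  assumes v: "v \<in> entries" and "1 < pre v"
  shows "\<exists>u\<in>entries. u \<sqsubset> v \<and> Suc (pre u) = pre v"
proof (cases "v \<in> upper")
  case True
  then obtain k where k: "A (r, k) = Some v" by (rule upper_position)
  let ?S = "insert 0 ({j. \<exists>b. A (r + 1, j) = Some b \<and> b \<sqsubset> v} \<union> upper_column le A r ` {1..<k})"
  have pre_v: "pre v = Max ?S + 1"
    using pre_upper[OF k] upper_column.simps[of le A r k] k by simp
  have "Max ?S \<in> ?S" using finite_upper_column_candidates by (rule Max_in) simp
  moreover have "Max ?S \<noteq> 0" using pre_v assms(2) by simp
  ultimately consider b where "A (r + 1, Max ?S) = Some b" "b \<sqsubset> v"
    | j where "1 \<le> j" "j < k" "Max ?S = upper_column le A r j"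
    by force
  then show ?thesis
  proof cases
    case (1 b)
    then have "b \<in> entries" by (auto simp: entries_def lower_def row_def)
    then show ?thesis using 1 pre_lower[OF 1(1)] pre_v by (intro bexI[of _ b]) simp_all
  next
    case (2 j)
    then obtain u where u: "A (r, j) = Some u"
      using array_defined_below[OF array k] by force
    then have "u \<in> entries" by (auto simp: entries_def upper_def row_def)
    then show ?thesis
      using array_increasing[OF array u k 2(2)] pre_upper[OF u] pre_v 2(3)
      by (intro bexI[of _ u]) simp_all
  qed
next
  case False
  then have "v \<in> lower" using v by (simp add: entries_def)
  then obtain j where j: "A (r + 1, j) = Some v" by (rule lower_position)
  then have "1 < j" using assms(2) pre_lower by simp
  then have "1 \<le> j - 1" by simp
  then obtain u where u: "A (r + 1, j - 1) = Some u"
    using array_defined_below[OF array j, of "j - 1"] by auto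
  then have "u \<in> entries" by (auto simp: entries_def lower_def row_def)
  then show ?thesis
    using array_increasing[OF array u j] pre_lower[OF u] pre_lower[OF j] \<open>1 < j\<close>
    by (intro bexI[of _ u]) simp_all
qed

lemma movable_iff:
  "movable le A r \<phi> x \<longleftrightarrow> x \<in> entries \<and> (\<exists>y\<in>entries. \<phi> y = Suc (\<phi> x)) \<and>
     (\<forall>y\<in>entries. \<phi> y = Suc (\<phi> x) \<longrightarrow> \<not> x \<sqsubset> y)"
  unfolding movable_def entries_def upper_def lower_def by auto

text \<open>
  The invariant of the alignment process. Call \<open>v\<close> moved if \<open>\<phi> v \<noteq> pre v\<close>. The third clause
  says that the process sweeps from right to left: what can still move started weakly left of
  everything that has moved. The fourth clause says that a moved entry always shares its column
  with an entry of the other row that started strictly to the right of it. Both serve the last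
  clause, that no column is ever emptied. The choice of the rightmost movable entry enters
  through the third clause.
\<close>
definition aligning :: "(nat \<Rightarrow> nat) \<Rightarrow> bool" where
  "aligning \<phi> \<longleftrightarrow>
     (\<forall>v\<in>entries. pre v \<le> \<phi> v) \<and>
     (\<forall>u\<in>entries. \<forall>v\<in>entries. u \<sqsubset> v \<and> pre u < pre v \<longrightarrow> \<phi> u < \<phi> v) \<and>
     (\<forall>x z. movable le A r \<phi> x \<and> z \<in> entries \<and> \<phi> z \<noteq> pre z \<longrightarrow> pre x \<le> pre z) \<and>
     (\<forall>v\<in>entries. \<phi> v \<noteq> pre v \<longrightarrow>
        (\<exists>w\<in>entries. (w \<in> upper \<longleftrightarrow> v \<notin> upper) \<and> \<phi> w = \<phi> v \<and> pre v < pre w)) \<and>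
     \<phi> ` entries = pre ` entries"

lemma aligning_pre: "aligning pre"
  by (simp add: aligning_def)

lemma aligning_mono:
  assumes "aligning \<phi>" "u \<in> entries" "v \<in> entries" "u \<sqsubset> v" "u \<in> upper \<longrightarrow> v \<in> upper"
  shows "\<phi> u < \<phi> v"
  using assms pre_mono unfolding aligning_def by blast

text \<open>
  Let \<open>x\<close> move from column \<open>c\<close> to column \<open>c + 1\<close>. Since nothing in column \<open>c + 1\<close> is above
  \<open>x\<close>, all entries there belong to the other row; let \<open>w\<close> be one. This \<open>w\<close> has not moved, since a moved
  \<open>w\<close> would have a partner in the row of \<open>x\<close> there. So \<open>w\<close> still has its initial predecessor
  in column \<open>c\<close>, which is not \<open>x\<close> and keeps this column occupied; and \<open>w\<close> is the partner of
  \<open>x\<close> after the move. The remaining point is that the departure of \<open>x\<close> can make an entry \<open>v\<close> of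
  column \<open>c - 1\<close> movable. If \<open>x\<close> had moved before and \<open>v\<close> started right of \<open>x\<close>, then \<open>v\<close> would
  be in the other row, and the partner of \<open>x\<close> in column \<open>c\<close> would still block it.
\<close>
lemma aligning_step:
  assumes inv: "aligning \<phi>" and mov: "movable le A r \<phi> x"
    and rightmost: "\<And>y. movable le A r \<phi> y \<Longrightarrow> \<phi> y \<le> \<phi> x"
  shows "aligning (\<phi>(x := \<phi> x + 1))"
proof -
  let ?\<phi> = "\<phi>(x := \<phi> x + 1)"
  have grow: "pre v \<le> \<phi> v" if "v \<in> entries" for v
    using inv that unfolding aligning_def by blast
  have mono: "\<phi> u < \<phi> v" if "u \<in> entries" "v \<in> entries" "u \<sqsubset> v" "pre u < pre v" for u v
    using inv that unfolding aligning_def by blast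
  have order: "pre y \<le> pre z" if "movable le A r \<phi> y" "z \<in> entries" "\<phi> z \<noteq> pre z" for y z
    using inv that unfolding aligning_def by blast
  have partner: "\<exists>w\<in>entries. (w \<in> upper \<longleftrightarrow> v \<notin> upper) \<and> \<phi> w = \<phi> v \<and> pre v < pre w"
    if "v \<in> entries" "\<phi> v \<noteq> pre v" for v
    using inv that unfolding aligning_def by blast
  have image: "\<phi> ` entries = pre ` entries"
    using inv unfolding aligning_def by blast
  have x: "x \<in> entries" and free: "\<And>y. y \<in> entries \<Longrightarrow> \<phi> y = Suc (\<phi> x) \<Longrightarrow> \<not> x \<sqsubset> y"
    using mov by (auto simp: movable_iff)
  obtain w where w: "w \<in> entries" "\<phi> w = Suc (\<phi> x)"
    using mov by (auto simp: movable_iff)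
  have opposite: "y \<in> upper \<longleftrightarrow> x \<notin> upper" if "y \<in> entries" "\<phi> y = Suc (\<phi> x)" for y
  proof (rule ccontr)
    assume "\<not> (y \<in> upper \<longleftrightarrow> x \<notin> upper)"
    then have same: "y \<in> upper \<longleftrightarrow> x \<in> upper" by blast
    have "y \<noteq> x" using that by auto
    then have "y \<sqsubset> x" using same_row_chain[OF that(1) x same] free[OF that] by blast
    then have "\<phi> y < \<phi> x" using aligning_mono[OF inv that(1) x] same by blast
    then show False using that(2) by simp
  qed
  have unmoved: "\<phi> w = pre w"
    using partner[OF w(1)] opposite w by metis
  have "1 < pre w" using pre_pos[OF x] grow[OF x] w(2) unmoved by simp
  then obtain y where y: "y \<in> entries" "y \<sqsubset> w" "Suc (pre y) = pre w"
    using pre_predecessor[OF w(1)] by blast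
  have col_y: "\<phi> y = \<phi> x"
    using mono[OF y(1) w(1) y(2)] y(3) grow[OF y(1)] unmoved w(2) by simp
  have "y \<noteq> x" using y(2) free[OF w] by blast
  have "w \<noteq> x" using w(2) by auto
  have grow': "pre v \<le> ?\<phi> v" if "v \<in> entries" for v
    using grow[OF that] by auto
  have mono': "?\<phi> u < ?\<phi> v" if "u \<in> entries" "v \<in> entries" "u \<sqsubset> v" "pre u < pre v" for u v
    using mono[OF that] free[of v] that by (auto simp: less_Suc_eq dest: Suc_lessI)
  have order': "pre v \<le> pre z"
    if v: "movable le A r ?\<phi> v" and z: "z \<in> entries" "?\<phi> z \<noteq> pre z" for v z
  proof (cases "v = x")
    case True
    then show ?thesis using order[OF mov z(1)] z(2) by (cases "z = x") auto
  next
    case False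
    have ve: "v \<in> entries" using v by (simp add: movable_iff)
    show ?thesis
    proof (cases "movable le A r \<phi> v")
      case True
      show ?thesis
      proof (cases "\<phi> z = pre z")
        case False
        then show ?thesis using order[OF True z(1)] by blast
      next
        case unmoved_z: True
        then have "z = x" using z(2) by (auto split: if_splits)
        then show ?thesis using rightmost[OF True] grow[OF ve] unmoved_z by simp
      qed
    next
      case notmov: False
      have "\<exists>y\<in>entries. \<phi> y = Suc (\<phi> v)"
      proof -
        obtain y where "y \<in> entries" "?\<phi> y = Suc (\<phi> v)"
          using v False by (auto simp: movable_iff)
        then show ?thesis using w by (cases "y = x") auto
      qed
      then obtain b where b: "b \<in> entries" "\<phi> b = Suc (\<phi> v)" "v \<sqsubset> b"
        using notmov ve by (auto simp: movable_iff)
      have bx: "b = x"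
        using v False b by (auto simp: movable_iff split: if_splits)
      have "pre v \<le> pre x"
      proof (rule ccontr)
        assume less: "\<not> pre v \<le> pre x"
        then have "\<phi> x \<noteq> pre x" using grow[OF ve] b(2) bx by simp
        then obtain w2 where w2: "w2 \<in> entries" "w2 \<in> upper \<longleftrightarrow> x \<notin> upper" "\<phi> w2 = \<phi> x"
          using partner[OF x] by blast
        have "\<not> (v \<in> upper \<longleftrightarrow> x \<in> upper)"
          using pre_mono[OF ve x] b(3) bx less by auto
        then have same: "v \<in> upper \<longleftrightarrow> w2 \<in> upper" using w2(2) by blast
        have "\<phi> w2 = Suc (\<phi> v)" using w2(3) b(2) bx by simp
        moreover have "v \<noteq> w2" using calculation by auto
        moreover have "\<not> w2 \<sqsubset> v"
          using aligning_mono[OF inv w2(1) ve] same calculation by auto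
        ultimately have "v \<sqsubset> w2" using same_row_chain[OF ve w2(1) same] by blast
        moreover have "w2 \<noteq> x" using w2(2) by auto
        ultimately show False
          using v False w2(1) \<open>\<phi> w2 = Suc (\<phi> v)\<close> by (auto simp: movable_iff)
      qed
      then show ?thesis using order[OF mov z(1)] z(2) by (cases "z = x") auto
    qed
  qed
  have partner': "\<exists>w\<in>entries. (w \<in> upper \<longleftrightarrow> v \<notin> upper) \<and> ?\<phi> w = ?\<phi> v \<and> pre v < pre w"
    if v: "v \<in> entries" "?\<phi> v \<noteq> pre v" for v
  proof (cases "v = x")
    case True
    have "pre x < pre w" using grow[OF x] w(2) unmoved by simp
    then show ?thesis using opposite[OF w] w \<open>w \<noteq> x\<close> True by (intro bexI[of _ w]) auto
  next
    case False
    then have "\<phi> v \<noteq> pre v" using v(2) by simp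
    then obtain w2 where w2: "w2 \<in> entries" "w2 \<in> upper \<longleftrightarrow> v \<notin> upper" "\<phi> w2 = \<phi> v" "pre v < pre w2"
      using partner[OF v(1)] by blast
    then have "w2 \<noteq> x" using order[OF mov v(1) \<open>\<phi> v \<noteq> pre v\<close>] by auto
    then show ?thesis using w2 False by (intro bexI[of _ w2]) auto
  qed
  have image': "?\<phi> ` entries = \<phi> ` entries"
  proof (intro equalityI subsetI)
    fix c assume "c \<in> ?\<phi> ` entries"
    then obtain v where "v \<in> entries" "c = ?\<phi> v" by blast
    then show "c \<in> \<phi> ` entries" using w by (cases "v = x") (auto intro: rev_image_eqI)
  next
    fix c assume "c \<in> \<phi> ` entries"
    then obtain v where v: "v \<in> entries" "c = \<phi> v" by blast
    show "c \<in> ?\<phi> ` entries"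
    proof (cases "v = x")
      case True
      then have "c = ?\<phi> y" using v(2) col_y \<open>y \<noteq> x\<close> by simp
      then show ?thesis using y(1) by (rule image_eqI)
    next
      case False
      then have "c = ?\<phi> v" using v(2) by simp
      then show ?thesis using v(1) by (rule image_eqI)
    qed
  qed
  have image'': "?\<phi> ` entries = pre ` entries"
    using image' image by simp
  show ?thesis
    unfolding aligning_def
  proof (intro conjI ballI allI impI)
    show "pre v \<le> ?\<phi> v" if "v \<in> entries" for v using grow'[OF that] .
    show "?\<phi> u < ?\<phi> v" if "u \<in> entries" "v \<in> entries" "u \<sqsubset> v \<and> pre u < pre v" for u v
      using mono'[OF that(1,2)] that(3) by blast
    show "pre y \<le> pre z" if "movable le A r ?\<phi> y \<and> z \<in> entries \<and> ?\<phi> z \<noteq> pre z" for y z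
      using order' that by blast
    show "\<exists>w\<in>entries. (w \<in> upper \<longleftrightarrow> v \<notin> upper) \<and> ?\<phi> w = ?\<phi> v \<and> pre v < pre w"
      if "v \<in> entries" "?\<phi> v \<noteq> pre v" for v
      using partner'[OF that] .
  qed (rule image'')
qed

lemma alignment_aligned:
  "aligning (alignment le A r) \<and> (\<forall>x. \<not> movable le A r (alignment le A r) x)"
proof -
  define K where "K = Max (pre ` entries)"
  define slack where "slack \<phi> = (\<Sum>v\<in>entries. K - \<phi> v)" for \<phi> :: "nat \<Rightarrow> nat"
  have bound: "\<phi> v \<le> K" if "aligning \<phi>" "v \<in> entries" for \<phi> v
  proof -
    have "\<phi> v \<in> pre ` entries" using that unfolding aligning_def by blast
    then show ?thesis unfolding K_def using finite_entries by (intro Max_ge) auto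
  qed
  have step: "aligning (alignment_step le A r \<phi>) \<and> slack (alignment_step le A r \<phi>) < slack \<phi>"
    if inv: "aligning \<phi>" and ex: "\<exists>x. movable le A r \<phi> x" for \<phi>
  proof -
    define x where "x = arg_max \<phi> (movable le A r \<phi>)"
    obtain x0 where x0: "movable le A r \<phi> x0" using ex by blast
    have "\<forall>y. movable le A r \<phi> y \<longrightarrow> \<phi> y < Suc K"
      using bound[OF inv] by (auto simp: movable_iff less_Suc_eq_le)
    from arg_max_nat_lemma[of "movable le A r \<phi>", OF x0 this]
    have x: "movable le A r \<phi> x" "\<And>y. movable le A r \<phi> y \<Longrightarrow> \<phi> y \<le> \<phi> x"
      unfolding x_def by auto
    have eq: "alignment_step le A r \<phi> = \<phi>(x := \<phi> x + 1)"
      by (simp add: alignment_step_def x_def Let_def)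
    have inv': "aligning (alignment_step le A r \<phi>)"
      unfolding eq using aligning_step[OF inv x] .
    have xe: "x \<in> entries" using x(1) by (simp add: movable_iff)
    have "\<phi> x < K"
      using bound[OF inv' xe] by (simp add: eq)
    then have "slack (alignment_step le A r \<phi>) < slack \<phi>"
      unfolding slack_def eq using finite_entries xe
      by (intro sum_strict_mono_ex1) auto
    then show ?thesis using inv' by blast
  qed
  \<comment> \<open>The columns stay in the image of the initial ones, so the total distance to the last
    column is a bound on the number of moves.\<close>
  show ?thesis
    unfolding alignment_def
  proof (rule while_rule[where P = aligning and r = "measure slack"])
    show "aligning pre" by (rule aligning_pre)
  qed (use step in auto)
qed

abbreviation col :: "nat \<Rightarrow> nat" where "col \<equiv> alignment le A r"

lemma pre_columns_contiguous:
  assumes "v \<in> entries" "1 \<le> d" "d \<le> pre v"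
  shows "d \<in> pre ` entries"
  using assms(3,2)
proof (induction d rule: inc_induct)
  case base
  show ?case using assms(1) by simp
next
  case (step d)
  then obtain w where w: "w \<in> entries" "pre w = Suc d" by force
  then have "1 < pre w" using step.prems by simp
  then obtain u where "u \<in> entries" "Suc (pre u) = pre w"
    using pre_predecessor[OF w(1)] by blast
  then show ?case using w(2) by force
qed

lemma col_image: "col ` entries = pre ` entries"
  using alignment_aligned unfolding aligning_def by blast

lemma col_pos: "v \<in> entries \<Longrightarrow> 1 \<le> col v"
  using alignment_aligned pre_pos[of v] unfolding aligning_def by (meson le_trans)

lemma columns_contiguous:
  assumes "v \<in> entries" "1 \<le> d" "d \<le> col v"
  obtains u where "u \<in> entries" "col u = d"
proof -
  have "col v \<in> pre ` entries" using assms(1) col_image by blast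
  then obtain w where "w \<in> entries" "pre w = col v" by force
  then have "d \<in> col ` entries"
    using pre_columns_contiguous assms(2,3) col_image by simp
  then show thesis using that by blast
qed

lemma col_mono:
  assumes "u \<in> entries" "v \<in> entries" "u \<sqsubset> v" "u \<in> upper \<longrightarrow> v \<in> upper"
  shows "col u < col v"
  using aligning_mono assms alignment_aligned by blast

lemma col_blocked:
  assumes "u \<in> entries" "v \<in> entries" "col v = Suc (col u)"
  obtains y where "y \<in> entries" "col y = Suc (col u)" "u \<sqsubset> y"
  using alignment_aligned assms that unfolding movable_iff by blast

lemma lower_entries: "y \<in> lower \<Longrightarrow> y \<in> entries \<and> y \<notin> upper"
  using upper_lower_disjoint by (auto simp: entries_def)

lemma upper_entries: "y \<in> upper \<Longrightarrow> y \<in> entries"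
  by (auto simp: entries_def)

lemma lower_col_less_iff:
  assumes "u \<in> lower" "v \<in> lower"
  shows "col u < col v \<longleftrightarrow> u \<sqsubset> v"
  using assms col_mono[of u v] col_mono[of v u] same_row_chain[of u v] lower_entries
  by (metis less_asym less_irrefl)

lemma upper_col_less_iff:
  assumes "u \<in> upper" "v \<in> upper"
  shows "col u < col v \<longleftrightarrow> u \<sqsubset> v"
  using assms col_mono[of u v] col_mono[of v u] same_row_chain[of u v] upper_entries
  by (metis less_asym less_irrefl)

lemma lower_col_inj:
  assumes "u \<in> lower" "v \<in> lower" "col u = col v" shows "u = v"
  using assms lower_col_less_iff[OF assms(1,2)] lower_col_less_iff[OF assms(2,1)]
    same_row_chain[of u v] lower_entries by auto

lemma upper_col_inj:
  assumes "u \<in> upper" "v \<in> upper" "col u = col v" shows "u = v"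
  using assms upper_col_less_iff[OF assms(1,2)] upper_col_less_iff[OF assms(2,1)]
    same_row_chain[of u v] upper_entries by auto

lemma lower_not_prec_upper:
  assumes "y \<in> lower" "x \<in> upper" "col x \<le> col y"
  shows "\<not> y \<sqsubset> x"
  using col_mono[of y x] assms lower_entries upper_entries by fastforce

text \<open>
  In a common column an upper entry may be below a lower entry, but not conversely.
\<close>
lemma lower_upper_incomparable:
  assumes "y \<in> lower" "x \<in> upper" "col x \<le> col y" "\<not> x \<sqsubset> y"
  shows "y \<parallel> x"
  using assms lower_not_prec_upper[OF assms(1-3)] upper_lower_disjoint[of x] entries_subset
    lower_entries upper_entries by (auto simp: inc_iff)

end

section \<open>The entries moved by a lowering operator\<close>

locale lowering_run = adjacent_rows +
  assumes some_unpaired: "unpaired A col r (r + 1) \<noteq> {}"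
begin

definition p :: nat where "p = Min (unpaired A col r (r + 1))"
definition t :: nat where "t = run_length le A col r (r + 1) p"
definition run :: "nat set" where "run = {x. \<exists>k\<in>{p..p + t}. A (r, k) = Some x}"
definition partners :: "nat set" where "partners = {y \<in> lower. \<exists>x\<in>run. col y = col x}"

lemma finite_columns: "finite {k. \<exists>x. A (i, k) = Some x}"
proof (rule finite_subset)
  show "{k. \<exists>x. A (i, k) = Some x} \<subseteq> snd ` dom A" by force
qed (use P_array_finite_dom[OF finite_P array] in simp)

lemma unpaired_lower:
  "unpaired A col r (r + 1) = {k. \<exists>x. A (r, k) = Some x \<and> (\<forall>y\<in>lower. col y \<noteq> col x)}"
  by (simp add: unpaired_def lower_def)

lemma p_unpaired: "\<exists>x. A (r, p) = Some x \<and> (\<forall>y\<in>lower. col y \<noteq> col x)"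
proof -
  have "finite (unpaired A col r (r + 1))"
    unfolding unpaired_def by (rule finite_subset[OF _ finite_columns]) auto
  from Min_in[OF this some_unpaired] show ?thesis
    unfolding p_def unpaired_lower by blast
qed

lemma before_p_paired:
  assumes "A (r, k) = Some x" "k < p"
  shows "\<exists>y\<in>lower. col y = col x"
proof (rule ccontr)
  assume "\<not> ?thesis"
  then have "k \<in> unpaired A col r (r + 1)"
    using assms(1) unfolding unpaired_lower by blast
  moreover have "finite (unpaired A col r (r + 1))"
    unfolding unpaired_def by (rule finite_subset[OF _ finite_columns]) auto
  ultimately show False using assms(2) Min_le unfolding p_def by fastforce
qed

definition first :: nat where "first = the (A (r, p))"

lemma first: "A (r, p) = Some first" "\<And>y. y \<in> lower \<Longrightarrow> col y \<noteq> col first"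
  using p_unpaired unfolding first_def by auto

lemma in_upper: "A (r, k) = Some x \<Longrightarrow> x \<in> upper"
  by (auto simp: upper_def row_def)

lemma p_pos: "1 \<le> p"
  using first(1) array by (auto simp: P_arrays_def)

text \<open>
  The last upper entry \<open>x\<close> ends every run: if the next column contains a lower entry, then what
  blocks \<open>x\<close> there can only be that entry.
\<close>
lemma run_terminates:
  "\<exists>s x. A (r, p + s) = Some x \<and> \<not> (\<exists>y\<in>row A (r + 1). col y = col x + 1 \<and> \<not> x \<sqsubset> y)"
proof -
  let ?K = "{k. \<exists>x. A (r, k) = Some x}"
  define m where "m = Max ?K"
  have pK: "p \<in> ?K" using first(1) by simp
  have "m \<in> ?K" unfolding m_def using finite_columns pK by (intro Max_in) auto
  then obtain x where x: "A (r, m) = Some x" by blast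
  have "p \<le> m" unfolding m_def using finite_columns pK by (intro Max_ge) auto
  have "x \<sqsubset> y" if y: "y \<in> lower" "col y = col x + 1" for y
  proof -
    have xe: "x \<in> entries" "y \<in> entries" using in_upper[OF x] y lower_entries upper_entries by auto
    then obtain z where z: "z \<in> entries" "col z = Suc (col x)" "x \<sqsubset> z"
      using col_blocked[of x y] y(2) by auto
    have "z \<notin> upper"
    proof
      assume "z \<in> upper"
      then obtain k where k: "A (r, k) = Some z" by (rule upper_position)
      then have "k \<le> m" unfolding m_def using finite_columns by (intro Max_ge) auto
      then show False using position_less[OF x k z(3)] by simp
    qed
    then have "z \<in> lower" using z(1) by (simp add: entries_def)
    then show ?thesis using lower_col_inj[of z y] y z by simp
  qed
  then show ?thesis
    using x \<open>p \<le> m\<close> by (intro exI[of _ "m - p"] exI[of _ x]) (auto simp: lower_def)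
qed

definition final :: nat where "final = the (A (r, p + t))"

lemma final: "A (r, p + t) = Some final"
  and after_final: "\<And>y. y \<in> lower \<Longrightarrow> col y = Suc (col final) \<Longrightarrow> final \<sqsubset> y"
proof -
  have "\<exists>x. A (r, p + t) = Some x \<and> \<not> (\<exists>y\<in>row A (r + 1). col y = col x + 1 \<and> \<not> x \<sqsubset> y)"
    unfolding t_def run_length_def by (rule LeastI_ex) (rule run_terminates)
  then show "A (r, p + t) = Some final"
    "\<And>y. y \<in> lower \<Longrightarrow> col y = Suc (col final) \<Longrightarrow> final \<sqsubset> y"
    unfolding final_def lower_def by auto
qed

text \<open>
  One step of the run. The lower entry \<open>y\<close> that continues the run does not block \<open>x\<close>, so the
  next upper entry does, and stands in the column of \<open>y\<close>. Thus the run and its partners form a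
  path in the incomparability graph that begins and ends in the upper row.
\<close>
lemma run_link:
  assumes "s < t" and x: "A (r, p + s) = Some x"
  obtains x' y where "A (r, Suc (p + s)) = Some x'" "y \<in> lower" "col x' = Suc (col x)"
    "col y = Suc (col x)" "x \<sqsubset> x'" "y \<parallel> x" "y \<parallel> x'"
proof -
  have "\<exists>y\<in>row A (r + 1). col y = col x + 1 \<and> \<not> x \<sqsubset> y"
    using not_less_Least[OF assms(1)[unfolded t_def run_length_def]] x by blast
  then obtain y where y: "y \<in> lower" "col y = Suc (col x)" "\<not> x \<sqsubset> y"
    by (auto simp: lower_def)
  have xu: "x \<in> upper" using in_upper[OF x] .
  obtain z where z: "z \<in> entries" "col z = Suc (col x)" "x \<sqsubset> z"
    using col_blocked[of x y] y xu lower_entries upper_entries by auto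
  have "z \<notin> lower" using lower_col_inj[of z y] y z by auto
  then have zu: "z \<in> upper" using z(1) by (simp add: entries_def)
  obtain x' where x': "A (r, Suc (p + s)) = Some x'"
    using array_defined_below[OF array final, of "Suc (p + s)"] assms(1) by auto
  have xx': "x \<sqsubset> x'" using array_step[OF array x' x] .
  obtain k where k: "A (r, k) = Some z" using zu by (rule upper_position)
  have "p + s < k" using position_less[OF x k z(3)] .
  then have "x' = z \<or> x' \<sqsubset> z"
    using array_increasing[OF array x' k] x' k by (cases "k = Suc (p + s)") auto
  then have "col x' \<le> col z" using upper_col_less_iff[OF in_upper[OF x'] zu] by auto
  moreover have "col x < col x'" using upper_col_less_iff[OF xu in_upper[OF x']] xx' by simp
  ultimately have cx': "col x' = Suc (col x)" using z(2) by simp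
  have "\<not> x' \<sqsubset> y" using y(3) prec_trans[OF xx'] by blast
  then show thesis
    using that[OF x' y(1) cx' y(2) xx'] lower_upper_incomparable[OF y(1) xu _ y(3)]
      lower_upper_incomparable[OF y(1) in_upper[OF x']] y(2) cx' by simp
qed

lemma run_col:
  assumes "s \<le> t" "A (r, p + s) = Some x"
  shows "col x = col first + s"
  using assms
proof (induction s arbitrary: x)
  case 0
  then show ?case using first by simp
next
  case (Suc s)
  obtain x0 where x0: "A (r, p + s) = Some x0"
    using array_defined_below[OF array Suc.prems(2), of "p + s"] p_pos by auto
  have "s < t" using Suc.prems(1) by simp
  then obtain x' where "A (r, Suc (p + s)) = Some x'" "col x' = Suc (col x0)"
    using run_link[OF _ x0] by metis
  then show ?case using Suc.IH[OF _ x0] Suc.prems by simp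
qed

lemma run_position:
  assumes "x \<in> run"
  obtains s where "s \<le> t" "A (r, p + s) = Some x"
proof -
  obtain k where "k \<in> {p..p + t}" "A (r, k) = Some x" using assms by (auto simp: run_def)
  then show thesis using that[of "k - p"] by auto
qed

lemma run_subset: "x \<in> run \<Longrightarrow> x \<in> upper"
  using in_upper by (auto simp: run_def)

lemma partners_subset: "y \<in> partners \<Longrightarrow> y \<in> lower"
  by (simp add: partners_def)

text \<open>
  A partner comes from a link of the run, because the first entry of the run shares its
  column with no lower entry.
\<close>
lemma partner_neighbours:
  assumes "y \<in> partners"
  obtains x x' where "x \<in> run" "x' \<in> run" "x \<sqsubset> x'" "y \<parallel> x" "y \<parallel> x'"
proof -
  obtain z where z: "y \<in> lower" "z \<in> run" "col y = col z" using assms by (auto simp: partners_def)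
  obtain s where s: "s \<le> t" "A (r, p + s) = Some z" using z(2) by (rule run_position)
  have "s \<noteq> 0"
  proof
    assume "s = 0"
    then have "z = first" using s(2) first(1) by simp
    then show False using first(2)[OF z(1)] z(3) by simp
  qed
  then obtain s' where s': "s = Suc s'" using not0_implies_Suc by blast
  obtain x where x: "A (r, p + s') = Some x"
    using array_defined_below[OF array s(2), of "p + s'"] p_pos s' by auto
  obtain x' y' where l: "A (r, Suc (p + s')) = Some x'" "y' \<in> lower" "col x' = Suc (col x)"
    "col y' = Suc (col x)" "x \<sqsubset> x'" "y' \<parallel> x" "y' \<parallel> x'"
    using run_link[OF _ x] s(1) s' by auto
  have "x' = z" using l(1) s(2) s' by simp
  then have "y' = y" using lower_col_inj[OF l(2) z(1)] l(3,4) z(3) by simp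
  moreover have "x \<in> run" using x s(1) s' unfolding run_def by force
  ultimately show thesis using that[of x x'] l \<open>x' = z\<close> z(2) by simp
qed

lemma incomparable_in_chain:
  assumes "x \<sqsubset> x'" "y \<parallel> x" "y \<parallel> x'" "z \<parallel> y"
    and "z = x \<or> z \<sqsubset> x \<or> x \<sqsubset> z" "z = x' \<or> z \<sqsubset> x' \<or> x' \<sqsubset> z"
  shows "z = x \<or> z = x'"
  using assms no_three_incomparables[of z x x' y] no_three_incomparables[of x z x' y]
    no_three_incomparables[of x x' z y] inc_sym by blast

lemma partner_incomparable_upper:
  assumes "y \<in> partners" "z \<in> upper" "z \<parallel> y"
  shows "z \<in> run"
proof -
  obtain x x' where x: "x \<in> run" "x' \<in> run" "x \<sqsubset> x'" "y \<parallel> x" "y \<parallel> x'"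
    using partner_neighbours[OF assms(1)] .
  have "z = x \<or> z = x'"
    using incomparable_in_chain[OF x(3-5) assms(3)] same_row_chain[of z x] same_row_chain[of z x']
      run_subset x(1,2) assms(2) upper_entries by blast
  then show ?thesis using x by blast
qed

text \<open>
  The column before \<open>first\<close> contains a lower entry: every upper entry before \<open>first\<close> shares
  its column with one. That entry cannot move any more, and the only entry that can block it
  is \<open>first\<close>.
\<close>
lemma lower_before_first:
  assumes y: "y \<in> lower" "col y < col first"
  shows "y \<sqsubset> first"
proof -
  have fu: "first \<in> upper" using in_upper[OF first(1)] .
  obtain d where d: "col first = Suc d" "1 \<le> d" "col y \<le> d"
    using y(2) col_pos[of y] lower_entries[OF y(1)] by (cases "col first") auto
  obtain v where v: "v \<in> entries" "col v = d"
    using columns_contiguous[of first d] d upper_entries[OF fu] by auto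
  have "\<exists>b\<in>lower. col b = d"
  proof (cases "v \<in> upper")
    case True
    then obtain k where k: "A (r, k) = Some v" by (rule upper_position)
    have "v \<sqsubset> first" using upper_col_less_iff[OF True fu] v(2) d(1) by simp
    then have "k < p" using position_less[OF k first(1)] by blast
    then show ?thesis using before_p_paired[OF k] v(2) by simp
  next
    case False
    then show ?thesis using v by (auto simp: entries_def)
  qed
  then obtain b where b: "b \<in> lower" "col b = d" by blast
  obtain z where z: "z \<in> entries" "col z = Suc d" "b \<sqsubset> z"
    using col_blocked[of b first] b d(1) lower_entries[OF b(1)] upper_entries[OF fu] by auto
  have "z \<notin> lower" using first(2)[of z] z(2) d(1) by auto
  then have "z = first" using upper_col_inj[OF _ fu, of z] z d(1) by (auto simp: entries_def)
  then have "b \<sqsubset> first" using z(3) by simp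
  moreover have "y = b \<or> y \<sqsubset> b"
    using lower_col_inj[OF y(1) b(1)] lower_col_less_iff[OF y(1) b(1)] d(3) b(2) by linarith
  ultimately show ?thesis using prec_trans by blast
qed

text \<open>
  Consider the leftmost lower entry \<open>b\<close> after \<open>final\<close>. In the next column it is above \<open>final\<close>
  since the run stopped there. If it stands further right and is not above \<open>final\<close>, then the
  next two columns are occupied, and \<open>final\<close> together with the entries that block there forms a
  chain of three upper entries, all of them incomparable to \<open>b\<close>.
\<close>
lemma lower_after_final:
  assumes y: "y \<in> lower" "col final < col y"
  shows "final \<sqsubset> y"
proof -
  let ?L = "{y \<in> lower. col final < col y}"
  have fu: "final \<in> upper" using in_upper[OF final] .
  define b where "b = arg_min_on col ?L"
  have fin: "finite ?L" using finite_entries by (rule finite_subset[rotated]) (auto simp: entries_def)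
  have "b \<in> ?L" unfolding b_def using fin y by (intro arg_min_if_finite(1)) auto
  then have b: "b \<in> lower" "col final < col b" by auto
  have least: "col b \<le> col z" if "z \<in> lower" "col final < col z" for z
    using arg_min_least[OF fin, of z col] that unfolding b_def by auto
  have "final \<sqsubset> b"
  proof (rule ccontr)
    assume nb: "\<not> final \<sqsubset> b"
    have far: "Suc (Suc (col final)) \<le> col b"
      using after_final[OF b(1)] nb b(2) by (metis Suc_leI le_antisym not_less_eq_eq)
    have be: "b \<in> entries" using lower_entries[OF b(1)] by blast
    obtain v1 where "v1 \<in> entries" "col v1 = Suc (col final)"
      using columns_contiguous[OF be, of "Suc (col final)"] far by auto
    then obtain z1 where z1: "z1 \<in> entries" "col z1 = Suc (col final)" "final \<sqsubset> z1"
      using col_blocked[of final v1] upper_entries[OF fu] by auto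
    have z1u: "z1 \<in> upper" using least[of z1] z1 far by (force simp: entries_def)
    obtain v2 where "v2 \<in> entries" "col v2 = Suc (Suc (col final))"
      using columns_contiguous[OF be, of "Suc (Suc (col final))"] far by auto
    then obtain z2 where z2: "z2 \<in> entries" "col z2 = Suc (Suc (col final))" "z1 \<sqsubset> z2"
      using col_blocked[of z1 v2] z1 by auto
    have "final \<sqsubset> z2" using prec_trans z1(3) z2(3) by blast
    have "z2 \<noteq> b" using \<open>final \<sqsubset> z2\<close> nb by blast
    have "z2 \<notin> lower"
    proof
      assume "z2 \<in> lower"
      then have "col b = col z2" using least[of z2] far z2(2) by simp
      then show False using lower_col_inj[OF b(1) \<open>z2 \<in> lower\<close>] \<open>z2 \<noteq> b\<close> by simp
    qed
    then have z2u: "z2 \<in> upper" using z2(1) by (simp add: entries_def)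
    have "b \<parallel> final" using lower_upper_incomparable[OF b(1) fu] far nb by simp
    moreover have "b \<parallel> z1"
      using lower_upper_incomparable[OF b(1) z1u] far z1 nb prec_trans by simp blast
    moreover have "b \<parallel> z2"
      using lower_upper_incomparable[OF b(1) z2u] far z2 \<open>final \<sqsubset> z2\<close> nb prec_trans by simp blast
    ultimately show False using no_three_incomparables[OF z1(3) z2(3)] by blast
  qed
  moreover have "b = y \<or> b \<sqsubset> y"
    using lower_col_inj[OF b(1) y(1)] lower_col_less_iff[OF b(1) y(1)] least[OF y] by linarith
  ultimately show ?thesis using prec_trans by blast
qed

text \<open>
  The columns of the run are consecutive, so a lower entry that is not a partner stands
  left of \<open>first\<close> or right of \<open>final\<close>.
\<close>
lemma run_incomparable_lower:
  assumes x: "x \<in> run" and y: "y \<in> lower" "x \<parallel> y"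
  shows "y \<in> partners"
proof (rule ccontr)
  assume np: "y \<notin> partners"
  obtain s where s: "s \<le> t" "A (r, p + s) = Some x" using x by (rule run_position)
  have range: "first = x \<or> first \<sqsubset> x" "x = final \<or> x \<sqsubset> final"
    using array_increasing[OF array first(1) s(2)] array_increasing[OF array s(2) final] s first(1) final
    by (cases "s = 0"; cases "s = t"; simp)+
  have "\<not> col y < col first"
    using lower_before_first[OF y(1)] range(1) prec_trans y(2) by (auto simp: inc_iff)
  moreover have "\<not> col final < col y"
    using lower_after_final[OF y(1)] range(2) prec_trans y(2) by (auto simp: inc_iff)
  ultimately have c: "col first \<le> col y" "col y \<le> col first + t"
    using run_col[OF _ final] by auto
  define d where "d = col y - col first"
  have "d \<le> t" using c d_def by simp
  moreover from this obtain z where z: "A (r, p + d) = Some z"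
    using array_defined_below[OF array final, of "p + d"] p_pos by auto
  ultimately have "z \<in> run" "col z = col y"
    using z run_col[OF _ z] c(1) d_def unfolding run_def by force+
  then show False using np y(1) by (auto simp: partners_def)
qed

section \<open>Invariance of the number of ascents\<close>

abbreviation color :: "nat \<Rightarrow> nat" where "color \<equiv> coloring_of A"

text \<open>
  The result of the lowering operator, described by the row of each element.
\<close>
definition swapped :: "nat \<Rightarrow> nat" where
  "swapped v = (if v \<in> run then r + 1 else if v \<in> partners then r else color v)"

lemma color_upper: "v \<in> upper \<longleftrightarrow> v \<in> P \<and> color v = r"
  unfolding upper_def row_eq_fibre[OF array] by blast

lemma color_lower: "v \<in> lower \<longleftrightarrow> v \<in> P \<and> color v = r + 1"
  unfolding lower_def row_eq_fibre[OF array] by blast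

lemma run_not_partner: "v \<in> run \<Longrightarrow> v \<notin> partners"
  using run_subset partners_subset upper_lower_disjoint by blast

lemma run_neighbour:
  assumes "x \<in> run" "v \<in> entries" "x \<parallel> v"
  shows "v \<in> partners"
proof -
  have "v \<notin> upper"
    using same_row_chain[of x v] assms run_subset[OF assms(1)] upper_entries inc_iff[of x v] by blast
  then show ?thesis
    using run_incomparable_lower assms by (auto simp: entries_def)
qed

lemma partner_neighbour:
  assumes "y \<in> partners" "v \<in> entries" "y \<parallel> v"
  shows "v \<in> run"
proof -
  have "v \<notin> lower"
    using same_row_chain[of y v] assms partners_subset[OF assms(1)] lower_entries inc_iff[of y v] by blast
  then show ?thesis
    using partner_incomparable_upper[OF assms(1)] assms(2,3) inc_sym by (auto simp: entries_def)
qed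

lemma color_outside:
  assumes "v \<in> P" "v \<notin> entries"
  shows "color v \<noteq> r" "color v \<noteq> r + 1" "swapped v = color v"
  using assms color_upper[of v] color_lower[of v] run_subset[of v] partners_subset[of v]
  by (auto simp: entries_def swapped_def)

lemma swapped_run: "v \<in> run \<Longrightarrow> swapped v = r + 1"
  by (simp add: swapped_def)

lemma swapped_partner: "v \<in> partners \<Longrightarrow> swapped v = r"
  using run_not_partner by (auto simp: swapped_def)

lemma swapped_ne:
  assumes uv: "u \<parallel> v" and u: "u \<in> run \<union> partners"
  shows "swapped u \<noteq> swapped v"
proof (cases "v \<in> entries")
  case True
  then show ?thesis
    using u run_neighbour[OF _ True uv] partner_neighbour[OF _ True uv]
      swapped_run swapped_partner by (metis UnE n_not_Suc_n Suc_eq_plus1)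
next
  case False
  have "v \<in> P" using uv by (simp add: inc_iff)
  from color_outside[OF this False] show ?thesis
    using u swapped_run swapped_partner by auto
qed

lemma swapped_proper:
  assumes "1 \<le> r"
  shows "swapped \<in> proper_colorings P (inc_edges P le)"
  unfolding proper_colorings_def
proof (intro CollectI conjI ballI)
  note c = coloring_of_proper[OF array]
  show "swapped \<in> P \<rightarrow>\<^sub>E {1..}"
  proof (rule PiE_I)
    fix v assume "v \<in> P"
    then have "1 \<le> color v" using c by (auto simp: proper_colorings_def PiE_iff)
    then show "swapped v \<in> {1..}" using assms by (simp add: swapped_def)
  next
    fix v assume "v \<notin> P"
    then have "v \<notin> run" "v \<notin> partners"
      using run_subset partners_subset color_upper color_lower by blast+
    then show "swapped v = undefined" using \<open>v \<notin> P\<close> by (simp add: swapped_def coloring_of_def)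
  qed
  fix e assume "e \<in> inc_edges P le"
  then obtain u v where e: "e = (u, v)" and uv: "u \<parallel> v" by (auto simp: inc_edges_def)
  have "swapped u \<noteq> swapped v"
  proof (cases "u \<in> run \<union> partners \<or> v \<in> run \<union> partners")
    case True
    then show ?thesis using swapped_ne uv inc_sym by metis
  next
    case False
    then show ?thesis using proper_coloring_inc[OF c uv] by (simp add: swapped_def)
  qed
  then show "case e of (u, v) \<Rightarrow> swapped u \<noteq> swapped v" using e by simp
qed

text \<open>
  The run together with its partners is closed under incomparability within the two rows, and
  an element of any other row compares with \<open>r\<close> and \<open>r + 1\<close> in the same way. So only pairs of a run
  entry and a partner can be affected.
\<close>
lemma swapped_order:
  assumes uv: "u \<parallel> v"
    and "\<not> (u \<in> run \<and> v \<in> partners)" "\<not> (u \<in> partners \<and> v \<in> run)"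
  shows "swapped u < swapped v \<longleftrightarrow> color u < color v"
proof -
  have P: "u \<in> P" "v \<in> P" using uv by (auto simp: inc_iff)
  have vu: "v \<parallel> u" using uv inc_sym by blast
  have T: "(color x = r \<or> color x = r + 1) \<and> (swapped x = r \<or> swapped x = r + 1)"
    if "x \<in> run \<union> partners" for x
    using that run_subset[of x] partners_subset[of x] color_upper color_lower
      swapped_run[of x] swapped_partner[of x] by auto
  consider "u \<in> run \<union> partners" | "v \<in> run \<union> partners" | "u \<notin> run \<union> partners" "v \<notin> run \<union> partners"
    by blast
  then show ?thesis
  proof cases
    case 1
    then have "v \<notin> entries"
      using run_neighbour[OF _ _ uv] partner_neighbour[OF _ _ uv] assms(2,3) by blast
    from color_outside[OF P(2) this] show ?thesis using T[OF 1] by auto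
  next
    case 2
    then have "u \<notin> entries"
      using run_neighbour[OF _ _ vu] partner_neighbour[OF _ _ vu] assms(2,3) by blast
    from color_outside[OF P(1) this] show ?thesis using T[OF 2] by auto
  qed (simp add: swapped_def)
qed

text \<open>
  A partner is incomparable to exactly two entries of the run, and lies between them as a
  number. So it contributes exactly one ascent before the swap, and, by the next lemma, exactly
  one after it.
\<close>
lemma card_ascents_from_run:
  "card {(x, y). x \<in> run \<and> y \<in> partners \<and> x \<parallel> y \<and> x < y} = card partners"
proof (rule bij_betw_same_card[where f = snd], unfold bij_betw_def, intro conjI)
  show "inj_on snd {(x, y). x \<in> run \<and> y \<in> partners \<and> x \<parallel> y \<and> x < y}"
  proof (rule inj_onI, clarsimp)
    fix x z y assume *: "x \<in> run" "z \<in> run" "x \<parallel> y" "z \<parallel> y" "x < y" "z < y"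
    show "x = z"
      using same_row_chain[of x z] run_subset[OF *(1)] run_subset[OF *(2)] upper_entries
        between_incomparables[of x z y] between_incomparables[of z x y] * inc_sym by fastforce
  qed
  show "snd ` {(x, y). x \<in> run \<and> y \<in> partners \<and> x \<parallel> y \<and> x < y} = partners"
  proof (intro equalityI subsetI)
    fix y assume y: "y \<in> partners"
    then obtain x x' where x: "x \<in> run" "x' \<in> run" "x \<sqsubset> x'" "y \<parallel> x" "y \<parallel> x'"
      by (rule partner_neighbours)
    then have "(x, y) \<in> {(x, y). x \<in> run \<and> y \<in> partners \<and> x \<parallel> y \<and> x < y}"
      using between_incomparables[OF x(3-5)] y inc_sym by blast
    then show "y \<in> snd ` {(x, y). x \<in> run \<and> y \<in> partners \<and> x \<parallel> y \<and> x < y}" by force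
  qed auto
qed

lemma card_ascents_to_run:
  "card {(y, x). y \<in> partners \<and> x \<in> run \<and> y \<parallel> x \<and> y < x} = card partners"
proof (rule bij_betw_same_card[where f = fst], unfold bij_betw_def, intro conjI)
  show "inj_on fst {(y, x). y \<in> partners \<and> x \<in> run \<and> y \<parallel> x \<and> y < x}"
  proof (rule inj_onI, clarsimp)
    fix x z y assume *: "x \<in> run" "z \<in> run" "y \<parallel> x" "y \<parallel> z" "y < x" "y < z"
    show "x = z"
      using same_row_chain[of x z] run_subset[OF *(1)] run_subset[OF *(2)] upper_entries
        between_incomparables[of x z y] between_incomparables[of z x y] * by fastforce
  qed
  show "fst ` {(y, x). y \<in> partners \<and> x \<in> run \<and> y \<parallel> x \<and> y < x} = partners"
  proof (intro equalityI subsetI)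
    fix y assume y: "y \<in> partners"
    then obtain x x' where x: "x \<in> run" "x' \<in> run" "x \<sqsubset> x'" "y \<parallel> x" "y \<parallel> x'"
      by (rule partner_neighbours)
    then have "(y, x') \<in> {(y, x). y \<in> partners \<and> x \<in> run \<and> y \<parallel> x \<and> y < x}"
      using between_incomparables[OF x(3-5)] y by blast
    then show "y \<in> fst ` {(y, x). y \<in> partners \<and> x \<in> run \<and> y \<parallel> x \<and> y < x}" by force
  qed auto
qed

text \<open>
  The swap loses one ascent for each partner and gains one for each partner.
\<close>
lemma asc_swapped:
  "asc_coloring (inc_edges P le) swapped = asc_coloring (inc_edges P le) color"
proof -
  let ?old = "{(u, v) \<in> inc_edges P le. color u < color v \<and> u < v}"
  let ?new = "{(u, v) \<in> inc_edges P le. swapped u < swapped v \<and> u < v}"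
  let ?lost = "{(x, y). x \<in> run \<and> y \<in> partners \<and> x \<parallel> y \<and> x < y}"
  let ?gained = "{(y, x). y \<in> partners \<and> x \<in> run \<and> y \<parallel> x \<and> y < x}"
  have run_color: "color x = r" "swapped x = r + 1" if "x \<in> run" for x
    using that run_subset color_upper swapped_run by blast+
  have partner_color: "color y = r + 1" "swapped y = r" if "y \<in> partners" for y
    using that partners_subset color_lower swapped_partner by blast+
  have lost: "?old - ?new = ?lost"
  proof (intro set_eqI iffI)
    fix e assume e: "e \<in> ?old - ?new"
    then obtain u v where uv: "e = (u, v)" "u \<parallel> v" "color u < color v" "u < v"
      "\<not> swapped u < swapped v" by (auto simp: inc_edges_def)
    then have "\<not> (u \<in> partners \<and> v \<in> run)" using run_color partner_color by fastforce
    then show "e \<in> ?lost" using swapped_order[OF uv(2)] uv by blast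
  qed (auto simp: inc_edges_def run_color partner_color)
  have gained: "?new - ?old = ?gained"
  proof (intro set_eqI iffI)
    fix e assume e: "e \<in> ?new - ?old"
    then obtain u v where uv: "e = (u, v)" "u \<parallel> v" "swapped u < swapped v" "u < v"
      "\<not> color u < color v" by (auto simp: inc_edges_def)
    then have "\<not> (u \<in> run \<and> v \<in> partners)" using run_color partner_color by fastforce
    then show "e \<in> ?gained" using swapped_order[OF uv(2)] uv by blast
  qed (auto simp: inc_edges_def run_color partner_color)
  have "inc_edges P le \<subseteq> P \<times> P" by (auto simp: inc_edges_def incomparable_def)
  then have "finite (inc_edges P le)" using finite_P finite_subset by blast
  then have fin: "finite ?old" "finite ?new" by (auto intro: finite_subset[rotated])
  have "card ?old = card (?old \<inter> ?new) + card ?lost"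
    using card_Un_disjoint[of "?old \<inter> ?new" "?old - ?new"] fin unfolding lost[symmetric]
    by (simp add: Int_Diff_Un Int_Diff_disjoint)
  moreover have "card ?new = card (?new \<inter> ?old) + card ?gained"
    using card_Un_disjoint[of "?new \<inter> ?old" "?new - ?old"] fin unfolding gained[symmetric]
    by (simp add: Int_Diff_Un Int_Diff_disjoint)
  ultimately show ?thesis
    unfolding asc_coloring_def card_ascents_from_run card_ascents_to_run by (simp add: Int_commute)
qed

lemma rows_swapped:
  "row (array_of swapped) =
     (row A)(r := (row A r - run) \<union> partners, r + 1 := (row A (r + 1) - partners) \<union> run)"
proof
  fix i
  have "v \<in> row (array_of swapped) i \<longleftrightarrow> v \<in> ((row A)(r := (row A r - run) \<union> partners,
      r + 1 := (row A (r + 1) - partners) \<union> run)) i" for v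
    using run_subset[of v] partners_subset[of v] color_upper[of v] color_lower[of v]
      run_not_partner[of v]
    by (auto simp: row_array_of row_eq_fibre[OF array] swapped_def)
  then show "row (array_of swapped) i = ((row A)(r := (row A r - run) \<union> partners,
      r + 1 := (row A (r + 1) - partners) \<union> run)) i" by blast
qed

lemma slide_eq:
  assumes "1 \<le> r"
  shows "slide P le A col r (r + 1) p = array_of swapped"
proof -
  have "slide P le A col r (r + 1) p = (THE B. B \<in> P_arrays P le \<and> row B = (row A)
      (r := (row A r - run) \<union> partners, r + 1 := (row A (r + 1) - partners) \<union> run))"
    by (simp only: slide_def Let_def run_def partners_def t_def lower_def)
  also have "\<dots> = array_of swapped"
  proof (rule the_equality)
    show "array_of swapped \<in> P_arrays P le \<and> row (array_of swapped) = (row A)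
      (r := (row A r - run) \<union> partners, r + 1 := (row A (r + 1) - partners) \<union> run)"
      using array_of_in_P_arrays[OF swapped_proper[OF assms]] rows_swapped by blast
  next
    fix B assume "B \<in> P_arrays P le \<and> row B = (row A)
      (r := (row A r - run) \<union> partners, r + 1 := (row A (r + 1) - partners) \<union> run)"
    then show "B = array_of swapped"
      using array_determined_by_rows[OF _ array_of_in_P_arrays[OF swapped_proper[OF assms]]]
        rows_swapped by metis
  qed
  finally show ?thesis .
qed

lemma slide_preserves:
  assumes "1 \<le> r"
  shows "slide P le A col r (r + 1) p \<in> P_arrays P le"
    and "asc P le (slide P le A col r (r + 1) p) = asc P le A"
proof -
  note proper = swapped_proper[OF assms]
  show mem: "slide P le A col r (r + 1) p \<in> P_arrays P le"
    unfolding slide_eq[OF assms] by (rule array_of_in_P_arrays[OF proper])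
  have "asc P le (array_of swapped) = asc_coloring (inc_edges P le) swapped"
    using asc_coloring_of[OF array_of_in_P_arrays[OF proper]] coloring_of_array_of[OF proper] by simp
  then show "asc P le (slide P le A col r (r + 1) p) = asc P le A"
    unfolding slide_eq[OF assms] asc_swapped asc_coloring_of[OF array] .
qed

end

section \<open>Summation over the components\<close>

context unit_interval_poset
begin

lemma lowering_preserves:
  assumes A: "A \<in> P_arrays P le" and r: "1 \<le> r" and B: "lowering P le r A = Some B"
  shows "B \<in> P_arrays P le \<and> asc P le B = asc P le A"
proof -
  let ?K = "unpaired A (alignment le A r) r (r + 1)"
  have K: "?K \<noteq> {}" and B': "B = slide P le A (alignment le A r) r (r + 1) (Min ?K)"
    using B by (auto simp: lowering_def Let_def split: if_splits)
  interpret lowering_run P le A r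
    using A K by unfold_locales auto
  show ?thesis using slide_preserves[OF r] unfolding B' p_def by blast
qed

abbreviation linked :: "parray rel" where
  "linked \<equiv> (crystal_edges P le \<union> (crystal_edges P le)\<inverse>)\<^sup>*"

lemma linked_asc:
  assumes "(A, B) \<in> linked" "A \<in> P_arrays P le"
  shows "B \<in> P_arrays P le \<and> asc P le B = asc P le A"
  using assms
proof (induction rule: rtrancl_induct)
  case (step B C)
  then have B: "B \<in> P_arrays P le" "asc P le B = asc P le A" by blast+
  from step.hyps(2) consider "(B, C) \<in> crystal_edges P le" | "(C, B) \<in> crystal_edges P le" by blast
  then show ?case
  proof cases
    case 1
    then show ?thesis using lowering_preserves[OF B(1)] B by (auto simp: crystal_edges_def)
  next
    case 2
    then show ?thesis using lowering_preserves[of C] B by (auto simp: crystal_edges_def)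
  qed
qed simp

lemma linked_sym: "(A, B) \<in> linked \<Longrightarrow> (B, A) \<in> linked"
  using sym_rtrancl[OF sym_Un_converse] by (rule symD)

lemma component_eq:
  assumes "C \<in> crystal_components P le" "A \<in> C"
  shows "C = linked `` {A}" "A \<in> P_arrays P le"
proof -
  obtain A0 where A0: "A0 \<in> P_arrays P le" "C = linked `` {A0}"
    using assms(1) unfolding crystal_components_def by (rule quotientE)
  then have A0A: "(A0, A) \<in> linked" using assms(2) by blast
  then show "A \<in> P_arrays P le" using linked_asc[OF _ A0(1)] by blast
  show "C = linked `` {A}"
  proof (intro equalityI subsetI)
    fix B assume "B \<in> C"
    then have "(A0, B) \<in> linked" using A0(2) by blast
    then have "(A, B) \<in> linked" by (rule rtrancl_trans[OF linked_sym[OF A0A]])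
    then show "B \<in> linked `` {A}" by blast
  next
    fix B assume "B \<in> linked `` {A}"
    then have "(A0, B) \<in> linked" using rtrancl_trans[OF A0A] by blast
    then show "B \<in> C" using A0(2) by blast
  qed
qed

lemma asc_component_eq:
  assumes "C \<in> crystal_components P le" "A \<in> C"
  shows "asc_component P le C = asc P le A"
proof -
  have "asc P le ` C = {asc P le A}"
  proof (intro equalityI subsetI)
    fix n assume "n \<in> asc P le ` C"
    then obtain B where "B \<in> C" "n = asc P le B" by blast
    moreover from this have "(A, B) \<in> linked" using component_eq(1)[OF assms] by blast
    ultimately show "n \<in> {asc P le A}" using linked_asc component_eq(2)[OF assms] by blast
  qed (use assms(2) in blast)
  then show ?thesis by (simp add: asc_component_def)
qed

definition arrays_of_weight :: "monomial \<Rightarrow> parray set" where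
  "arrays_of_weight \<mu> = {A \<in> P_arrays P le. weight_monomial A = \<mu>}"

lemma monomial_series_nonzero: "monomial_series m \<mu> \<noteq> 0 \<longleftrightarrow> m = \<mu>"
  by (simp add: monomial_series_def)

lemma finite_arrays_of_weight: "finite (arrays_of_weight \<mu>)"
  using char_summable[OF finite_P subset_refl, of le]
  unfolding formally_summable_def monomial_series_nonzero arrays_of_weight_def by blast

text \<open>
  The contribution of a component, spread over its arrays, where the exponent of \<open>q\<close> no longer
  refers to the component.
\<close>
lemma component_term:
  assumes C: "C \<in> crystal_components P le"
  shows "monom 1 (asc_component P le C) * char C \<mu> =
    (\<Sum>A \<in> {A \<in> arrays_of_weight \<mu>. linked `` {A} = C}. monom 1 (asc P le A))"
proof -
  have sets: "{A \<in> C. monomial_series (weight_monomial A) \<mu> \<noteq> 0} =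
      {A \<in> arrays_of_weight \<mu>. linked `` {A} = C}"
    unfolding monomial_series_nonzero arrays_of_weight_def
  proof (intro set_eqI iffI)
    fix A assume "A \<in> {A \<in> C. weight_monomial A = \<mu>}"
    then have A: "A \<in> C" "weight_monomial A = \<mu>" by blast+
    show "A \<in> {A \<in> {A \<in> P_arrays P le. weight_monomial A = \<mu>}. linked `` {A} = C}"
      using component_eq(1)[OF C A(1), symmetric] component_eq(2)[OF C A(1)] A(2) by blast
  qed blast
  have "monom 1 (asc_component P le C) * char C \<mu> =
      (\<Sum>A \<in> {A \<in> C. monomial_series (weight_monomial A) \<mu> \<noteq> 0}.
        monom 1 (asc_component P le C) * monomial_series (weight_monomial A) \<mu>)"
    unfolding char_def formal_sum_def by (rule sum_distrib_left)
  also have "\<dots> = (\<Sum>A \<in> {A \<in> C. monomial_series (weight_monomial A) \<mu> \<noteq> 0}. monom 1 (asc P le A))"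
  proof (rule sum.cong[OF refl])
    fix A assume "A \<in> {A \<in> C. monomial_series (weight_monomial A) \<mu> \<noteq> 0}"
    then have "A \<in> C" "monomial_series (weight_monomial A) \<mu> = 1"
      by (simp_all add: monomial_series_def split: if_splits)
    then show "monom 1 (asc_component P le C) * monomial_series (weight_monomial A) \<mu>
        = monom 1 (asc P le A)"
      using asc_component_eq[OF C] by simp
  qed
  finally show ?thesis unfolding sets .
qed

lemma chromatic_qsym_arrays:
  "chromatic_qsym P (inc_edges P le) \<mu> = (\<Sum>A \<in> arrays_of_weight \<mu>. monom 1 (asc P le A))"
proof -
  let ?F = "\<lambda>\<kappa>. monom 1 (asc_coloring (inc_edges P le) \<kappa>) * monomial_series (coloring_monomial P \<kappa>) \<mu>"
  have image: "coloring_of ` P_arrays P le = proper_colorings P (inc_edges P le)"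
    and inj: "inj_on coloring_of (P_arrays P le)"
    using bij_betw_coloring_of by (auto simp: bij_betw_def)
  have coeff: "?F (coloring_of A) = (if A \<in> arrays_of_weight \<mu> then monom 1 (asc P le A) else 0)"
    if "A \<in> P_arrays P le" for A
    using that asc_coloring_of[OF that] coloring_monomial_coloring_of[OF that]
    by (simp add: monomial_series_def arrays_of_weight_def)
  have support: "{\<kappa> \<in> proper_colorings P (inc_edges P le). ?F \<kappa> \<noteq> 0} = coloring_of ` arrays_of_weight \<mu>"
  proof (intro equalityI subsetI)
    fix \<kappa> assume "\<kappa> \<in> {\<kappa> \<in> proper_colorings P (inc_edges P le). ?F \<kappa> \<noteq> 0}"
    then obtain A where "A \<in> P_arrays P le" "\<kappa> = coloring_of A" "?F \<kappa> \<noteq> 0"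
      unfolding image[symmetric] by blast
    then show "\<kappa> \<in> coloring_of ` arrays_of_weight \<mu>" using coeff by (metis image_eqI)
  next
    fix \<kappa> assume "\<kappa> \<in> coloring_of ` arrays_of_weight \<mu>"
    then obtain A where A: "A \<in> arrays_of_weight \<mu>" "\<kappa> = coloring_of A" by blast
    then have "A \<in> P_arrays P le" by (simp add: arrays_of_weight_def)
    then have "\<kappa> \<in> proper_colorings P (inc_edges P le)" "?F \<kappa> \<noteq> 0"
      using A coeff image by (auto simp: monom_eq_0_iff)
    then show "\<kappa> \<in> {\<kappa> \<in> proper_colorings P (inc_edges P le). ?F \<kappa> \<noteq> 0}" by blast
  qed
  have "chromatic_qsym P (inc_edges P le) \<mu> = (\<Sum>\<kappa> \<in> coloring_of ` arrays_of_weight \<mu>. ?F \<kappa>)"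
    unfolding chromatic_qsym_def formal_sum_def support ..
  also have "\<dots> = (\<Sum>A \<in> arrays_of_weight \<mu>. ?F (coloring_of A))"
    using inj by (subst sum.reindex) (auto simp: arrays_of_weight_def intro: inj_on_subset)
  also have "\<dots> = (\<Sum>A \<in> arrays_of_weight \<mu>. monom 1 (asc P le A))"
    using coeff by (intro sum.cong) (auto simp: arrays_of_weight_def)
  finally show ?thesis .
qed

end

theorem corollary7p4:
  fixes P :: "nat set" and le :: "nat rel"
  assumes "natural_unit_interval_order P le"
  shows "has_formal_sum
           (\<lambda>C \<mu>. monom 1 (asc_component P le C) * char C \<mu>)
           (crystal_components P le)
           (chromatic_qsym P (inc_edges P le))"
proof -
  interpret unit_interval_poset P le using assms by unfold_locales
  let ?F = "\<lambda>C \<mu>. monom 1 (asc_component P le C) * char C \<mu> :: int poly"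
  let ?class = "\<lambda>A. linked `` {A}"
  have class_in: "?class ` arrays_of_weight \<mu> \<subseteq> crystal_components P le" for \<mu>
    by (auto simp: arrays_of_weight_def crystal_components_def intro: quotientI)
  have support: "{C \<in> crystal_components P le. ?F C \<mu> \<noteq> 0} \<subseteq> ?class ` arrays_of_weight \<mu>" for \<mu>
  proof
    fix C assume C: "C \<in> {C \<in> crystal_components P le. ?F C \<mu> \<noteq> 0}"
    then have C: "C \<in> crystal_components P le" "?F C \<mu> \<noteq> 0" by blast+
    have "{A \<in> arrays_of_weight \<mu>. ?class A = C} \<noteq> {}"
      using C(2) unfolding component_term[OF C(1)] by (metis sum.empty)
    then show "C \<in> ?class ` arrays_of_weight \<mu>" by blast
  qed
  have "formally_summable ?F (crystal_components P le)"
    unfolding formally_summable_def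
    using support finite_arrays_of_weight by (meson finite_imageI finite_subset)
  moreover have "formal_sum ?F (crystal_components P le) \<mu> = chromatic_qsym P (inc_edges P le) \<mu>" for \<mu>
  proof -
    have "formal_sum ?F (crystal_components P le) \<mu> = (\<Sum>C \<in> ?class ` arrays_of_weight \<mu>. ?F C \<mu>)"
      unfolding formal_sum_def
      using support[of \<mu>] class_in[of \<mu>] finite_arrays_of_weight
      by (intro sum.mono_neutral_left) auto
    also have "\<dots> = (\<Sum>C \<in> ?class ` arrays_of_weight \<mu>.
        \<Sum>A \<in> {A \<in> arrays_of_weight \<mu>. ?class A = C}. monom 1 (asc P le A))"
      using class_in[of \<mu>] by (intro sum.cong component_term) auto
    also have "\<dots> = (\<Sum>A \<in> arrays_of_weight \<mu>. monom 1 (asc P le A))"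
      by (rule sum.image_gen[symmetric]) (rule finite_arrays_of_weight)
    finally show ?thesis by (simp add: chromatic_qsym_arrays)
  qed
  ultimately show ?thesis unfolding has_formal_sum_def by blast
qed

end
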